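(* Let $\mu$ be a measure on the Borel subsets of $(0,\infty)$, let $\delta>0$, and let $$r_\mu(t)=\int_0^\infty\frac{2\lambda}{\lambda^2+4\pi^2t^2}\,d\mu(\lambda).$$ If $0<\int_0^\infty\frac{\lambda}{\lambda^2+1}\,d\mu(\lambda)<\infty$, then for all real numbers $\xi_0,\xi_1,\dots,\xi_N$ with $\delta\le|\xi_m-\xi_n|$ whenever $m\ne n$, $$-A(\delta,\mu)\sum_{n=0}^N|a_n|^2\le\sum_{m=0}^N\ \sum_{0\le n\le N,\ n\ne m}a_m\overline{a}_n\,r_\mu(\xi_m-\xi_n)$$ for all complex numbers $a_0,\dots,a_N$, where $$A(\delta,\mu)=\int_0^\infty\left\{\tfrac2\lambda-\tfrac1\delta\operatorname{csch}\left(\tfrac{\lambda}{2\delta}\right)\right\}d\mu(\lambda).$$ This inequality is sharp in the sense that the positive constant $A(\delta,\mu)$ cannot be replaced by a smaller number. If $0<\int_0^\infty\frac{\lambda}{\lambda+1}\,d\mu(\lambda)<\infty$, then for all real numbers $\xi_0,\xi_1,\dots,\xi_N$ with $\delta\le|\xi_m-\xi_n|$ whenever $m\ne n$, $$\sum_{m=0}^N\ \sum_{0\le n\le N,\ n\ne m}a_m\overline{a}_n\,r_\mu(\xi_m-\xi_n)\le B(\delta,\mu)\sum_{n=0}^N|a_n|^2$$ for all complex numbers $a_0,\dots,a_N$, where $$B(\delta,\mu)=\int_0^\infty\left\{\tfrac1\delta\coth\left(\tfrac{\lambda}{2\delta}\right)-\tfrac2\lambda\right\}d\mu(\lambda).$$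 This inequality is sharp in the sense that the positive constant $B(\delta,\mu)$ cannot be replaced by a smaller number.
   Context: $N$ is an arbitrary nonnegative integer, and $\overline{a}_n$ denotes the complex conjugate of $a_n$. Sharpness is understood for fixed $\mu$ and $\delta$, with the inequality required to hold for all $N$, all $\delta$-separated $\xi_0,\dots,\xi_N$ and all $a_0,\dots,a_N$: no smaller constant makes the inequality true in all these cases. *)

theory Defs
  imports "HOL-Analysis.Analysis" "HOL-Library.Complex_Order"
begin

definition csch :: "real \<Rightarrow> real" where
  "csch x = 1 / sinh x"

definition coth :: "real \<Rightarrow> real" where
  "coth x = cosh x / sinh x"

text \<open>
  Measures on the Borel subsets of \<open>(0, \<infinity>)\<close> live on the space \<open>{0<..}\<close>,
  so integrals over \<open>(0, \<infinity>)\<close> are plain integrals against \<open>\<mu>\<close>.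
  The integrals below are Bochner integrals, hence \<open>0\<close> when the integrand is not
  integrable.  For \<open>t = 0\<close> the integral \<open>r_kernel \<mu> t\<close> may diverge; that value is never used.
\<close>

definition r_kernel :: "real measure \<Rightarrow> real \<Rightarrow> real" where
  "r_kernel \<mu> t = (\<integral>x. 2 * x / (x\<^sup>2 + 4 * pi\<^sup>2 * t\<^sup>2) \<partial>\<mu>)"

definition A_const :: "real \<Rightarrow> real measure \<Rightarrow> real" where
  "A_const \<delta> \<mu> = (\<integral>x. 2 / x - 1 / \<delta> * csch (x / (2 * \<delta>)) \<partial>\<mu>)"

definition B_const :: "real \<Rightarrow> real measure \<Rightarrow> real" where
  "B_const \<delta> \<mu> = (\<integral>x. 1 / \<delta> * coth (x / (2 * \<delta>)) - 2 / x \<partial>\<mu>)"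

definition separated :: "real \<Rightarrow> nat \<Rightarrow> (nat \<Rightarrow> real) \<Rightarrow> bool" where
  "separated \<delta> N \<xi> \<longleftrightarrow> (\<forall>m\<le>N. \<forall>n\<le>N. m \<noteq> n \<longrightarrow> \<delta> \<le> \<bar>\<xi> m - \<xi> n\<bar>)"

definition hermitian_form ::
  "real measure \<Rightarrow> nat \<Rightarrow> (nat \<Rightarrow> real) \<Rightarrow> (nat \<Rightarrow> complex) \<Rightarrow> complex" where
  "hermitian_form \<mu> N \<xi> a =
    (\<Sum>m=0..N. \<Sum>n\<in>{0..N} - {m}. a m * cnj (a n) * complex_of_real (r_kernel \<mu> (\<xi> m - \<xi> n)))"

text \<open>
  In the two inequalities \<open>\<le>\<close> is the order of \<open>Complex_Order\<close>: the imaginary parts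
  agree (so the form is real) and the real parts are ordered.
\<close>

definition lower_inequality :: "real \<Rightarrow> real measure \<Rightarrow> real \<Rightarrow> bool" where
  "lower_inequality \<delta> \<mu> C \<longleftrightarrow>
    (\<forall>N \<xi> a. separated \<delta> N \<xi> \<longrightarrow>
      complex_of_real (- C * (\<Sum>n=0..N. (cmod (a n))\<^sup>2)) \<le> hermitian_form \<mu> N \<xi> a)"

definition upper_inequality :: "real \<Rightarrow> real measure \<Rightarrow> real \<Rightarrow> bool" where
  "upper_inequality \<delta> \<mu> C \<longleftrightarrow>
    (\<forall>N \<xi> a. separated \<delta> N \<xi> \<longrightarrow>
      hermitian_form \<mu> N \<xi> a \<le> complex_of_real (C * (\<Sum>n=0..N. (cmod (a n))\<^sup>2)))"

end

theory Submission
  imports Defs "HOL-Probability.Sinc_Integral"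
begin

text \<open>
  By linearity in \<open>\<mu>\<close> and scaling it suffices to treat a point mass at \<open>l\<close> and \<open>\<delta> = 1\<close>, where
  the kernel is \<open>kern l t\<close>. There one needs positive definite functions \<open>E\<close> and \<open>G\<close> with
  \<open>E t = kern l t\<close> and \<open>G t = - kern l t\<close> for \<open>\<bar>t\<bar> \<ge> 1\<close>, whose values at \<open>0\<close> are the two constants.
  Start from \<open>kern l t = 2 \<integral> exp (-2\<pi>\<bar>t\<bar>y) sin (l y) dy\<close> over \<open>y > 0\<close> and insert
  \<open>1 = cosh\<^sup>2 (\<pi>y) / cosh\<^sup>2 (\<pi>y)\<close>: for \<open>\<bar>t\<bar> \<ge> 1\<close>,
  \<open>exp (-2\<pi>\<bar>t\<bar>y) cosh\<^sup>2 (\<pi>y)\<close> is a combination of \<open>exp (-2\<pi>\<bar>t\<bar>y)\<close> and \<open>exp (-2\<pi>\<bar>t \<plusminus> 1\<bar>y)\<close>, and this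
  combination makes sense for all \<open>t\<close>. The resulting function is positive definite because
  \<open>1 / cosh\<^sup>2 (\<pi>y)\<close> is the cosine transform of the function \<open>(w/2) / sinh (w/2)\<close> (up to a factor),
  which is even and decreasing in \<open>\<bar>w\<bar>\<close>, so that it is a positive mixture of shift averages of the
  kernels \<open>kern w\<close>. The same works with \<open>sinh\<close> for \<open>G\<close>, after a regularisation at \<open>y = 0\<close>.
  The arithmetic progression \<open>\<xi> n = \<delta> n\<close> with \<open>a n = (\<plusminus>1)\<^sup>n\<close> is asymptotically extremal:
  its form is a Cesaro sum of partial sums that converge, by the partial fractions of
  \<open>coth\<close> and \<open>csch\<close>, to the constants.
\<close>

section \<open>Partial fractions\<close>

text \<open>Logarithmic derivative of the reflection formula
  \<open>Gamma z * Gamma (1 - z) = pi / sin (pi z)\<close>: both expressions are differentiated, and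
  the common factor \<open>G\<close>, which is nonzero, is cancelled.\<close>

lemma Digamma_reflection:
  fixes z :: complex
  assumes "z \<notin> \<int>"
  shows "Digamma z - Digamma (1 - z) = - of_real pi * cot (of_real pi * z)"
proof -
  have z: "z \<notin> \<int>\<^sub>\<le>\<^sub>0" "1 - z \<notin> \<int>\<^sub>\<le>\<^sub>0" "sin (of_real pi * z) \<noteq> 0"
    using assms Ints_diff[OF Ints_1, of "1 - z"]
    by (auto simp: sin_eq_0 dest: nonpos_Ints_Int)
  define G where "G = Gamma z * Gamma (1 - z)"
  have G: "G = of_real pi / sin (of_real pi * z)"
    unfolding G_def by (rule Gamma_reflection_complex)
  have "((\<lambda>w. Gamma w * Gamma (1 - w)) has_field_derivative G * (Digamma z - Digamma (1 - z))) (at z)"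
    unfolding G_def using z by (auto intro!: derivative_eq_intros simp: algebra_simps)
  moreover have "((\<lambda>w. of_real pi / sin (of_real pi * w)) has_field_derivative
      G * (- of_real pi * cot (of_real pi * z))) (at z)"
    unfolding G using z by (auto intro!: derivative_eq_intros simp: cot_def field_simps power2_eq_square)
  moreover have "(\<lambda>w. of_real pi / sin (of_real pi * w)) = (\<lambda>w::complex. Gamma w * Gamma (1 - w))"
    by (simp add: Gamma_reflection_complex)
  ultimately have "G * (Digamma z - Digamma (1 - z)) = G * (- of_real pi * cot (of_real pi * z))"
    by (metis DERIV_unique)
  moreover have "G \<noteq> 0" using z by (simp add: G)
  ultimately show ?thesis by (metis mult_left_cancel)
qed

text \<open>Derivative of \<open>Digamma_reflection\<close>. That identity holds only off the
  integers, so the two derivatives are compared on this open set.\<close>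

lemma Polygamma_1_reflection:
  fixes z :: complex
  assumes "z \<notin> \<int>"
  shows "Polygamma 1 z + Polygamma 1 (1 - z) = of_real (pi\<^sup>2) / sin (of_real pi * z) ^ 2"
proof -
  have z: "z \<notin> \<int>\<^sub>\<le>\<^sub>0" "1 - z \<notin> \<int>\<^sub>\<le>\<^sub>0" "sin (of_real pi * z) \<noteq> 0"
    using assms Ints_diff[OF Ints_1, of "1 - z"]
    by (auto simp: sin_eq_0 dest: nonpos_Ints_Int)
  have "((\<lambda>w. Digamma w - Digamma (1 - w)) has_field_derivative
      Polygamma 1 z + Polygamma 1 (1 - z)) (at z)"
    using z by (auto intro!: derivative_eq_intros simp: algebra_simps)
  moreover have "((\<lambda>w. - of_real pi * cot (of_real pi * w)) has_field_derivative
      of_real (pi\<^sup>2) / sin (of_real pi * z) ^ 2) (at z)"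
    using z by (auto intro!: derivative_eq_intros DERIV_cot[THEN DERIV_chain2] simp: power2_eq_square divide_inverse)
  moreover have "open (- \<int> :: complex set)" using closed_Ints by (simp add: open_Compl)
  ultimately show ?thesis
    using assms Digamma_reflection
    by (metis (mono_tags, lifting) ComplI DERIV_unique has_field_derivative_transform_within_open ComplD)
qed

lemma inverse_square_add_cnj:
  fixes a y :: real
  assumes "a \<noteq> 0"
  shows "inverse ((of_real a + \<i> * of_real y)\<^sup>2) + inverse ((of_real a - \<i> * of_real y)\<^sup>2)
       = complex_of_real (2 * (a\<^sup>2 - y\<^sup>2) / (a\<^sup>2 + y\<^sup>2)\<^sup>2)"
proof -
  have pq: "(of_real a + \<i> * of_real y) * (of_real a - \<i> * of_real y) = complex_of_real (a\<^sup>2 + y\<^sup>2)"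
    by (simp add: algebra_simps power2_eq_square)
  have "a\<^sup>2 + y\<^sup>2 \<noteq> 0" using assms by (simp add: sum_power2_eq_zero_iff)
  then have ne: "of_real a + \<i> * of_real y \<noteq> 0" "of_real a - \<i> * of_real y \<noteq> 0"
    using pq by (metis mult_eq_0_iff of_real_eq_0_iff)+
  have "inverse (p\<^sup>2) + inverse (q\<^sup>2) = (q\<^sup>2 + p\<^sup>2) / (p * q)\<^sup>2" if "p \<noteq> 0" "q \<noteq> 0" for p q :: complex
    using that by (simp add: field_simps)
  then have "inverse ((of_real a + \<i> * of_real y)\<^sup>2) + inverse ((of_real a - \<i> * of_real y)\<^sup>2)
      = ((of_real a - \<i> * of_real y)\<^sup>2 + (of_real a + \<i> * of_real y)\<^sup>2) /
        ((of_real a + \<i> * of_real y) * (of_real a - \<i> * of_real y))\<^sup>2"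
    using ne by blast
  also have "(of_real a - \<i> * of_real y)\<^sup>2 + (of_real a + \<i> * of_real y)\<^sup>2
      = complex_of_real (2 * (a\<^sup>2 - y\<^sup>2))"
    by (simp add: algebra_simps power2_eq_square)
  finally show ?thesis unfolding pq by simp
qed

lemma sin_i_of_real: "sin (\<i> * complex_of_real x) = \<i> * of_real (sinh x)"
  by (simp add: sin_i_times sinh_field_def exp_of_real exp_minus)

lemma cos_i_of_real: "cos (\<i> * complex_of_real x) = of_real (cosh x)"
  using cos_i_times[of "of_real x"] by (simp add: cosh_field_def exp_of_real exp_minus)

lemma not_Ints_if_Im: "Im z \<noteq> 0 \<Longrightarrow> z \<notin> \<int>"
  by (auto elim!: Ints_cases)

text \<open>Trigamma reflection at \<open>z = 1/2 + i y\<close>: since \<open>1 - z\<close> is the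
  conjugate of \<open>z\<close>, the two trigamma series add up to real terms, and
  \<open>sin (pi z) = cosh (pi y)\<close>.\<close>

lemma sech_square_pfd:
  fixes y :: real
  assumes "y \<noteq> 0"
  shows "(\<lambda>k. 2 * ((real k + 1/2)\<^sup>2 - y\<^sup>2) / ((real k + 1/2)\<^sup>2 + y\<^sup>2)\<^sup>2) sums (pi\<^sup>2 / (cosh (pi * y))\<^sup>2)"
proof -
  define z :: complex where "z = 1/2 + \<i> * of_real y"
  have nz: "z \<noteq> 0" "1 - z \<noteq> 0" "z \<notin> \<int>"
    using assms by (auto simp: z_def complex_eq_iff intro!: not_Ints_if_Im)
  have "(\<lambda>k. inverse ((z + of_nat k)^2) + inverse ((1 - z + of_nat k)^2)) sums
      (Polygamma 1 z + Polygamma 1 (1 - z))"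
    using sums_add[OF Polygamma_LIMSEQ[of z 1] Polygamma_LIMSEQ[of "1 - z" 1]] nz
    by (simp add: numeral_2_eq_2)
  also have "(\<lambda>k. inverse ((z + of_nat k)^2) + inverse ((1 - z + of_nat k)^2)) =
      (\<lambda>k. complex_of_real (2 * ((real k + 1/2)\<^sup>2 - y\<^sup>2) / ((real k + 1/2)\<^sup>2 + y\<^sup>2)\<^sup>2))"
    by (subst inverse_square_add_cnj[symmetric]) (auto simp: z_def algebra_simps)
  also have "Polygamma 1 z + Polygamma 1 (1 - z) = complex_of_real (pi\<^sup>2 / (cosh (pi * y))\<^sup>2)"
  proof -
    have "of_real pi * z = of_real (pi / 2) + \<i> * of_real (pi * y)"
      by (simp add: z_def algebra_simps)
    then have "sin (of_real pi * z) = of_real (cosh (pi * y))"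
      by (simp only: sin_add sin_of_real cos_of_real cos_i_of_real) simp
    then show ?thesis using Polygamma_1_reflection[of z] nz by simp
  qed
  finally show ?thesis unfolding sums_of_real_iff .
qed

text \<open>The same at \<open>z = i y\<close>, where \<open>sin (pi z) = i sinh (pi y)\<close>. The
  series is taken at \<open>1 + z\<close> instead of \<open>z\<close>; this splits off the term
  \<open>1 / z^2 = - 1 / y^2\<close> of index 0 and produces the \<open>1 / y^2\<close> on the
  right.\<close>

lemma csch_square_pfd:
  fixes y :: real
  assumes "y \<noteq> 0"
  shows "(\<lambda>k. 2 * ((real k + 1)\<^sup>2 - y\<^sup>2) / ((real k + 1)\<^sup>2 + y\<^sup>2)\<^sup>2) sums (1 / y\<^sup>2 - pi\<^sup>2 / (sinh (pi * y))\<^sup>2)"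
proof -
  define z :: complex where "z = \<i> * of_real y"
  have nz: "z \<noteq> 0" "1 + z \<noteq> 0" "1 - z \<noteq> 0" "z \<notin> \<int>"
    using assms by (auto simp: z_def complex_eq_iff intro!: not_Ints_if_Im)
  have "(\<lambda>k. inverse ((1 + z + of_nat k)^2) + inverse ((1 - z + of_nat k)^2)) sums
      (Polygamma 1 (1 + z) + Polygamma 1 (1 - z))"
    using sums_add[OF Polygamma_LIMSEQ[of "1 + z" 1] Polygamma_LIMSEQ[of "1 - z" 1]] nz
    by (simp add: numeral_2_eq_2)
  also have "(\<lambda>k. inverse ((1 + z + of_nat k)^2) + inverse ((1 - z + of_nat k)^2)) =
      (\<lambda>k. complex_of_real (2 * ((real k + 1)\<^sup>2 - y\<^sup>2) / ((real k + 1)\<^sup>2 + y\<^sup>2)\<^sup>2))"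
    by (subst inverse_square_add_cnj[symmetric]) (auto simp: z_def algebra_simps)
  also have "Polygamma 1 (1 + z) + Polygamma 1 (1 - z) = complex_of_real (1 / y\<^sup>2 - pi\<^sup>2 / (sinh (pi * y))\<^sup>2)"
  proof -
    have "sin (of_real pi * z) = \<i> * of_real (sinh (pi * y))"
      using sin_i_of_real[of "pi * y"] by (simp add: z_def mult_ac)
    then have "Polygamma 1 z + Polygamma 1 (1 - z) = - of_real (pi\<^sup>2 / (sinh (pi * y))\<^sup>2)"
      using Polygamma_1_reflection[of z] nz by (simp add: power_mult_distrib)
    moreover have "Polygamma 1 (1 + z) = Polygamma 1 z + of_real (1 / y\<^sup>2)"
      using Polygamma_plus1[of z 1] nz by (simp add: z_def algebra_simps power2_eq_square)
    ultimately show ?thesis by simp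
  qed
  finally show ?thesis unfolding sums_of_real_iff .
qed

text \<open>Difference of the digamma series at \<open>1 + i y\<close> and \<open>1 - i y\<close>:
  the harmonic terms and the Euler constants cancel, and \<open>Digamma_reflection\<close> evaluates
  the result.\<close>

lemma coth_pfd:
  fixes y :: real
  assumes "y \<noteq> 0"
  shows "(\<lambda>k. 2 * y / ((real k + 1)\<^sup>2 + y\<^sup>2)) sums (pi * cosh (pi * y) / sinh (pi * y) - 1 / y)"
proof -
  define z :: complex where "z = \<i> * of_real y"
  have nz: "z \<noteq> 0" "1 + z \<noteq> 0" "1 - z \<noteq> 0" "z \<notin> \<int>"
    using assms by (auto simp: z_def complex_eq_iff intro!: not_Ints_if_Im)
  have "(\<lambda>k. (inverse (of_nat (Suc k)) - inverse (1 + z + of_nat k)) -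
             (inverse (of_nat (Suc k)) - inverse (1 - z + of_nat k))) sums
      ((Digamma (1 + z) + euler_mascheroni) - (Digamma (1 - z) + euler_mascheroni))"
    using sums_diff[OF summable_sums[OF summable_Digamma[of "1 + z"]]
          summable_sums[OF summable_Digamma[of "1 - z"]]] nz
    by (simp add: Digamma_def)
  also have "(\<lambda>k. (inverse (of_nat (Suc k)) - inverse (1 + z + of_nat k)) -
             (inverse (of_nat (Suc k)) - inverse (1 - z + of_nat k))) =
      (\<lambda>k. \<i> * complex_of_real (2 * y / ((real k + 1)\<^sup>2 + y\<^sup>2)))" (is "?l = ?r")
  proof
    fix k :: nat
    have pq: "(1 + of_nat k + z) * (1 + of_nat k - z) = complex_of_real ((real k + 1)\<^sup>2 + y\<^sup>2)"
      by (simp add: z_def algebra_simps power2_eq_square)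
    have ne: "1 + of_nat k + z \<noteq> 0" "1 + of_nat k - z \<noteq> 0"
      using assms by (auto simp: z_def complex_eq_iff)
    then have "?l k = 2 * z / ((1 + of_nat k + z) * (1 + of_nat k - z))"
      by (simp add: field_simps)
    then show "?l k = ?r k" unfolding pq by (simp add: z_def)
  qed
  also have "(Digamma (1 + z) + euler_mascheroni) - (Digamma (1 - z) + euler_mascheroni) =
      \<i> * complex_of_real (pi * cosh (pi * y) / sinh (pi * y) - 1 / y)"
  proof -
    have s: "sin (of_real pi * z) = \<i> * of_real (sinh (pi * y))"
      using sin_i_of_real[of "pi * y"] by (simp add: z_def mult_ac)
    have c: "cos (of_real pi * z) = of_real (cosh (pi * y))"
      using cos_i_of_real[of "pi * y"] by (simp add: z_def mult_ac)
    have "Digamma z - Digamma (1 - z) = \<i> * of_real (pi * cosh (pi * y) / sinh (pi * y))"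
      using Digamma_reflection[OF nz(4)] assms
      unfolding cot_def s c by (simp add: divide_inverse mult_ac)
    moreover have "Digamma (1 + z) = Digamma z - \<i> * of_real (1 / y)"
      using Digamma_plus1[of z] nz assms by (simp add: z_def add.commute divide_inverse)
    ultimately show ?thesis by (simp add: algebra_simps)
  qed
  finally have "(\<lambda>k. (- \<i>) * (\<i> * complex_of_real (2 * y / ((real k + 1)\<^sup>2 + y\<^sup>2)))) sums
     ((- \<i>) * (\<i> * complex_of_real (pi * cosh (pi * y) / sinh (pi * y) - 1 / y)))"
    by (rule sums_mult)
  then have "(\<lambda>k. complex_of_real (2 * y / ((real k + 1)\<^sup>2 + y\<^sup>2))) sums
     complex_of_real (pi * cosh (pi * y) / sinh (pi * y) - 1 / y)"
    by (simp only: mult.assoc[symmetric]) simp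
  then show ?thesis unfolding sums_of_real_iff .
qed

section \<open>Laplace integrals on the half-line\<close>

text \<open>A measure of its own instead of set integrals, so that Fubini and the convergence
  theorems apply without indicator functions and positivity of the variable comes from
  \<open>space\<close>.\<close>

definition lborel_pos :: "real measure" where
  "lborel_pos = restrict_space lborel {0<..}"

lemma space_lborel_pos [simp]: "space lborel_pos = {0<..}"
  by (simp add: lborel_pos_def space_restrict_space)

lemma measurable_lborel_pos [measurable (raw)]: "(\<lambda>x. x) \<in> borel_measurable lborel_pos"
  by (simp add: lborel_pos_def measurable_restrict_space1)

lemma borel_measurable_lborel_pos: "f \<in> borel_measurable borel \<Longrightarrow> f \<in> borel_measurable lborel_pos"
  by (simp add: lborel_pos_def measurable_restrict_space1)

interpretation lborel_pos: sigma_finite_measure lborel_pos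
  unfolding lborel_pos_def by (intro sigma_finite_measure_restrict_space) (auto intro: lborel.sigma_finite_measure_axioms)

interpretation lborel_pos: pair_sigma_finite lborel_pos lborel_pos ..

lemma integrable_lborel_pos:
  fixes f :: "real \<Rightarrow> 'a :: {banach, second_countable_topology}"
  shows "integrable lborel_pos f \<longleftrightarrow> integrable lborel (\<lambda>x. indicator {0<..} x *\<^sub>R f x)"
  by (simp add: lborel_pos_def integrable_restrict_space)

lemma integral_lborel_pos:
  fixes f :: "real \<Rightarrow> 'a :: {banach, second_countable_topology}"
  shows "integral\<^sup>L lborel_pos f = integral\<^sup>L lborel (\<lambda>x. indicator {0<..} x *\<^sub>R f x)"
  by (simp add: lborel_pos_def integral_restrict_space)

lemma has_bochner_integral_lborel_pos:
  fixes f :: "real \<Rightarrow> 'a :: {banach, second_countable_topology}"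
  shows "has_bochner_integral lborel_pos f c \<longleftrightarrow> has_bochner_integral lborel (\<lambda>x. indicator {0<..} x *\<^sub>R f x) c"
  by (simp add: has_bochner_integral_iff integrable_lborel_pos integral_lborel_pos)

lemma integrable_lborel_pos_I:
  fixes f :: "real \<Rightarrow> 'a :: {banach, second_countable_topology}"
  shows "integrable lborel f \<Longrightarrow> integrable lborel_pos f"
  by (simp add: integrable_lborel_pos integrable_mult_indicator)

lemma borel_measurable_lborel_pos_pair:
  assumes "f \<in> borel_measurable (borel \<Otimes>\<^sub>M borel)"
  shows "f \<in> borel_measurable (lborel_pos \<Otimes>\<^sub>M lborel_pos)"
proof -
  have "(\<lambda>p. (fst p, snd p)) \<in> lborel_pos \<Otimes>\<^sub>M lborel_pos \<rightarrow>\<^sub>M borel \<Otimes>\<^sub>M borel"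
    by (intro measurable_Pair measurable_compose[OF measurable_fst measurable_lborel_pos]
        measurable_compose[OF measurable_snd measurable_lborel_pos])
  from measurable_compose[OF this assms] show ?thesis by simp
qed

lemma has_bochner_integral_even:
  fixes f :: "real \<Rightarrow> real"
  assumes "has_bochner_integral lborel_pos f c" "\<And>x. f (- x) = f x"
  shows "has_bochner_integral lborel f (2 * c)"
proof -
  have "has_bochner_integral lborel (\<lambda>x. indicator {0..} x *\<^sub>R f x) c"
    using assms(1) unfolding has_bochner_integral_lborel_pos
    by (rule has_bochner_integral_discrete_difference[where X="{0}", THEN iffD1, rotated 4])
       (auto split: split_indicator)
  from has_bochner_integral_even_function[OF this assms(2)] show ?thesis by simp
qed

lemma integral_lborel_pos_even:
  fixes f :: "real \<Rightarrow> real"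
  assumes "integrable lborel f" "\<And>x. f (- x) = f x"
  shows "integral\<^sup>L lborel f = 2 * integral\<^sup>L lborel_pos f"
proof -
  have "has_bochner_integral lborel_pos f (integral\<^sup>L lborel_pos f)"
    using assms(1) by (intro has_bochner_integral_integrable integrable_lborel_pos_I)
  from has_bochner_integral_even[OF this assms(2)] show ?thesis
    by (simp add: has_bochner_integral_iff)
qed

lemma integral_lborel_odd:
  fixes f :: "real \<Rightarrow> real"
  assumes "\<And>x. f (- x) = - f x"
  shows "integral\<^sup>L lborel f = 0"
proof -
  have "integral\<^sup>L lborel f = integral\<^sup>L lborel (\<lambda>x. - f x)"
    using lborel_integral_real_affine[of "-1" f 0] assms by simp
  then show ?thesis by simp
qed

lemma integrable_power_exp_lborel_pos:
  fixes a :: real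
  assumes "a > 0"
  shows "integrable lborel_pos (\<lambda>x. x ^ k * exp (- (a * x)))"
proof -
  have "integrable lborel (\<lambda>x. (a * x)^k * exp (- (a * x)) * indicator {0<..} (a * x) :: real)"
    using lborel_integrable_real_affine[OF has_bochner_integral_I0i_power_exp_m[THEN integrable.intros], of a 0 k] assms
    by simp
  then have "integrable lborel (\<lambda>x. (1 / a^k) * ((a * x)^k * exp (- (a * x)) * indicator {0<..} (a * x)) :: real)"
    by (rule integrable_mult_right)
  also have "(\<lambda>x. (1 / a^k) * ((a * x)^k * exp (- (a * x)) * indicator {0<..} (a * x))) =
    (\<lambda>x. indicator {0<..} x *\<^sub>R (x ^ k * exp (- (a * x))))"
    using assms by (auto simp: fun_eq_iff indicator_def zero_less_mult_iff power_mult_distrib)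
  finally show ?thesis unfolding integrable_lborel_pos .
qed

lemma tendsto_power_exp_at_top:
  fixes a :: real
  assumes "a > 0"
  shows "((\<lambda>x. x ^ k * exp (- (a * x))) \<longlongrightarrow> 0) at_top"
proof -
  have "((\<lambda>x. (a * x) ^ k / exp (a * x)) \<longlongrightarrow> 0) at_top"
    using assms by (intro filterlim_compose[OF tendsto_power_div_exp_0]
        filterlim_tendsto_pos_mult_at_top[OF tendsto_const _ filterlim_ident])
  from tendsto_mult[OF tendsto_const[of "1 / a ^ k"] this]
  have "((\<lambda>x. 1 / a ^ k * ((a * x) ^ k / exp (a * x))) \<longlongrightarrow> 0) at_top" by simp
  also have "(\<lambda>x. 1 / a ^ k * ((a * x) ^ k / exp (a * x))) = (\<lambda>x. x ^ k * exp (- (a * x)))"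
    using assms by (simp add: fun_eq_iff power_mult_distrib exp_minus field_simps)
  finally show ?thesis .
qed

lemma has_bochner_integral_lborel_pos_FTC:
  fixes F f :: "real \<Rightarrow> complex"
  assumes "\<And>x. (F has_vector_derivative f x) (at x)" "continuous_on UNIV f"
    and "integrable lborel_pos f" "(F \<longlongrightarrow> 0) at_top"
  shows "has_bochner_integral lborel_pos f (- F 0)"
proof -
  have "(LBINT x=0..\<infinity>. f x) = 0 - F 0"
  proof (rule interval_integral_FTC_integrable[where F = F])
    show "set_integrable lborel (einterval 0 \<infinity>) f"
      using assms(3) unfolding set_integrable_def integrable_lborel_pos
      by (simp add: einterval_def zero_ereal_def greaterThan_def)
    have "isCont F 0" using assms(1) has_vector_derivative_continuous by blast
    then show "((F \<circ> real_of_ereal) \<longlongrightarrow> F 0) (at_right 0)"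
      by (simp add: zero_ereal_def ereal_tendsto_simps isCont_def filterlim_at_split)
    show "((F \<circ> real_of_ereal) \<longlongrightarrow> 0) (at_left \<infinity>)"
      using assms(4) by (simp add: ereal_tendsto_simps)
  qed (use assms in \<open>auto simp: continuous_on_eq_continuous_at\<close>)
  then have "integral\<^sup>L lborel_pos f = - F 0"
    by (simp add: interval_lebesgue_integral_0_infty set_lebesgue_integral_def integral_lborel_pos)
  then show ?thesis using assms(3) by (simp add: has_bochner_integral_iff)
qed

lemma
  fixes z :: complex
  assumes z: "Re z > 0"
  shows laplace_exp: "has_bochner_integral lborel_pos (\<lambda>x. exp (- (z * of_real x))) (1 / z)"
    and laplace_mult_exp: "has_bochner_integral lborel_pos (\<lambda>x. of_real x * exp (- (z * of_real x))) (1 / z\<^sup>2)"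
proof -
  have nz: "z \<noteq> 0" using z by auto
  have I: "integrable lborel_pos (\<lambda>x. of_real x ^ k * exp (- (z * of_real x)))" for k
  proof (rule Bochner_Integration.integrable_bound[OF integrable_power_exp_lborel_pos[OF z, of k]])
    show "AE x in lborel_pos. norm (of_real x ^ k * exp (- (z * of_real x))) \<le> norm (x ^ k * exp (- (Re z * x)))"
      by (simp add: norm_mult norm_power abs_mult power_abs)
  qed measurable
  have lim: "((\<lambda>x. of_real x ^ k * exp (- (z * of_real x))) \<longlongrightarrow> 0) at_top" for k
    by (rule tendsto_norm_zero_cancel, rule filterlim_cong[THEN iffD1, OF refl refl _ tendsto_power_exp_at_top[OF z, of k]])
      (auto simp: norm_mult norm_power intro!: eventually_mono[OF eventually_gt_at_top[of 0]])
  have "has_bochner_integral lborel_pos (\<lambda>x. exp (- (z * of_real x))) (- (- exp (- (z * of_real 0)) / z))"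
  proof (rule has_bochner_integral_lborel_pos_FTC[where F = "\<lambda>x. - exp (- (z * of_real x)) / z"])
    show "((\<lambda>x. - exp (- (z * of_real x)) / z) has_vector_derivative exp (- (z * of_real x))) (at x)" for x
      using nz by (auto intro!: derivative_eq_intros has_vector_derivative_real_field)
    show "((\<lambda>x. - exp (- (z * of_real x)) / z) \<longlongrightarrow> 0) at_top"
      using tendsto_mult[OF lim[of 0] tendsto_const[of "- 1 / z"]] by simp
    show "integrable lborel_pos (\<lambda>x. exp (- (z * of_real x)))" using I[of 0] by simp
  qed (auto intro!: continuous_intros)
  then show "has_bochner_integral lborel_pos (\<lambda>x. exp (- (z * of_real x))) (1 / z)" by simp
  have "has_bochner_integral lborel_pos (\<lambda>x. of_real x * exp (- (z * of_real x)))
      (- (- (of_real 0 / z + 1 / z\<^sup>2) * exp (- (z * of_real 0))))"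
  proof (rule has_bochner_integral_lborel_pos_FTC[where F = "\<lambda>x. - (of_real x / z + 1 / z\<^sup>2) * exp (- (z * of_real x))"])
    show "((\<lambda>x. - (of_real x / z + 1 / z\<^sup>2) * exp (- (z * of_real x))) has_vector_derivative
        of_real x * exp (- (z * of_real x))) (at x)" for x
      using nz by (auto intro!: derivative_eq_intros has_vector_derivative_real_field simp: field_simps power2_eq_square)
    show "((\<lambda>x. - (of_real x / z + 1 / z\<^sup>2) * exp (- (z * of_real x))) \<longlongrightarrow> 0) at_top"
      using tendsto_add[OF tendsto_mult[OF lim[of 1] tendsto_const[of "- 1 / z"]]
          tendsto_mult[OF lim[of 0] tendsto_const[of "- 1 / z\<^sup>2"]]] by (simp add: algebra_simps)
    show "integrable lborel_pos (\<lambda>x. of_real x * exp (- (z * of_real x)))" using I[of 1] by simp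
  qed (auto intro!: continuous_intros)
  then show "has_bochner_integral lborel_pos (\<lambda>x. of_real x * exp (- (z * of_real x))) (1 / z\<^sup>2)" by simp
qed

text \<open>Real and imaginary parts of the two complex Laplace integrals at
  \<open>z = a - i b\<close>.\<close>

lemma
  fixes a b :: real
  assumes "a > 0"
  shows laplace_cos: "has_bochner_integral lborel_pos (\<lambda>x. exp (- (a * x)) * cos (b * x)) (a / (a\<^sup>2 + b\<^sup>2))"
    and laplace_sin: "has_bochner_integral lborel_pos (\<lambda>x. exp (- (a * x)) * sin (b * x)) (b / (a\<^sup>2 + b\<^sup>2))"
    and laplace_mult_cos: "has_bochner_integral lborel_pos (\<lambda>x. x * exp (- (a * x)) * cos (b * x)) ((a\<^sup>2 - b\<^sup>2) / (a\<^sup>2 + b\<^sup>2)\<^sup>2)"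
proof -
  define z where "z = Complex a (- b)"
  have z: "Re z > 0" "z \<noteq> 0" using assms by (auto simp: z_def complex_eq_iff)
  have ReIm: "Re (exp (- (z * of_real x))) = exp (- (a * x)) * cos (b * x)"
       "Im (exp (- (z * of_real x))) = exp (- (a * x)) * sin (b * x)" for x
    by (simp_all add: z_def Re_exp Im_exp)
  have inv: "1 / z = Complex (a / (a\<^sup>2 + b\<^sup>2)) (b / (a\<^sup>2 + b\<^sup>2))"
    by (simp add: complex_eq_iff z_def Re_divide Im_divide)
  have inv2: "Re (1 / z\<^sup>2) = (a\<^sup>2 - b\<^sup>2) / (a\<^sup>2 + b\<^sup>2)\<^sup>2"
  proof -
    have "1 / z\<^sup>2 = (1 / z)\<^sup>2" by (simp add: power_divide)
    then show ?thesis unfolding inv by (simp add: power2_eq_square diff_divide_distrib)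
  qed
  note L = laplace_exp[OF z(1)] laplace_mult_exp[OF z(1)]
  show "has_bochner_integral lborel_pos (\<lambda>x. exp (- (a * x)) * cos (b * x)) (a / (a\<^sup>2 + b\<^sup>2))"
    using has_bochner_integral_bounded_linear[OF bounded_linear_Re L(1)] by (simp add: ReIm inv)
  show "has_bochner_integral lborel_pos (\<lambda>x. exp (- (a * x)) * sin (b * x)) (b / (a\<^sup>2 + b\<^sup>2))"
    using has_bochner_integral_bounded_linear[OF bounded_linear_Im L(1)] by (simp add: ReIm inv)
  show "has_bochner_integral lborel_pos (\<lambda>x. x * exp (- (a * x)) * cos (b * x)) ((a\<^sup>2 - b\<^sup>2) / (a\<^sup>2 + b\<^sup>2)\<^sup>2)"
    using has_bochner_integral_bounded_linear[OF bounded_linear_Re L(2)] by (simp add: ReIm inv2 mult.assoc)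
qed

lemma laplace_id:
  fixes a :: real
  assumes "a > 0"
  shows "has_bochner_integral lborel_pos (\<lambda>x. x * exp (- (a * x))) (1 / a\<^sup>2)"
proof -
  have "(a\<^sup>2 - 0\<^sup>2) / (a\<^sup>2 + 0\<^sup>2)\<^sup>2 = 1 / a\<^sup>2"
    using assms by (simp add: power2_eq_square)
  then show ?thesis using laplace_mult_cos[OF assms, of 0] by simp
qed

section \<open>Positive definite kernels\<close>

text \<open>The integrand of \<open>r_kernel\<close>, hence the kernel of a unit point mass at
  \<open>w\<close>. For \<open>w > 0\<close> it is, as a function of \<open>t\<close>, the Fourier
  transform of \<open>exp (- w \<bar>x\<bar>)\<close>.\<close>

definition kern :: "real \<Rightarrow> real \<Rightarrow> real" where
  "kern w t = 2 * w / (w\<^sup>2 + 4 * pi\<^sup>2 * t\<^sup>2)"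

text \<open>Only real coefficient vectors are tested, because \<open>hermitian_form_eq\<close>
  reduces the complex form to two real ones.\<close>

definition pos_def :: "(real \<Rightarrow> real) \<Rightarrow> bool" where
  "pos_def E \<longleftrightarrow> (\<forall>N (\<xi> :: nat \<Rightarrow> real) u. 0 \<le> (\<Sum>m=0..N. \<Sum>n=0..N. u m * u n * E (\<xi> m - \<xi> n)))"

text \<open>The addition formula makes the double sum a sum of two squares. All positive definite
  functions below are positive mixtures of these cosines, or limits of such mixtures.\<close>

lemma pos_def_cos: "pos_def (\<lambda>t. cos (a * t))"
  unfolding pos_def_def
proof (intro allI)
  fix N and \<xi> u :: "nat \<Rightarrow> real"
  have "(\<Sum>m=0..N. \<Sum>n=0..N. u m * u n * cos (a * (\<xi> m - \<xi> n)))
     = (\<Sum>m=0..N. u m * cos (a * \<xi> m))\<^sup>2 + (\<Sum>m=0..N. u m * sin (a * \<xi> m))\<^sup>2"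
    by (simp add: power2_eq_square sum_product right_diff_distrib cos_diff ring_distribs mult_ac
        flip: sum.distrib)
  then show "0 \<le> (\<Sum>m=0..N. \<Sum>n=0..N. u m * u n * cos (a * (\<xi> m - \<xi> n)))" by simp
qed

lemma pos_def_mult:
  assumes "c \<ge> 0" "pos_def E"
  shows "pos_def (\<lambda>t. c * E t)"
  unfolding pos_def_def
proof (intro allI)
  fix N and \<xi> u :: "nat \<Rightarrow> real"
  have "0 \<le> c * (\<Sum>m=0..N. \<Sum>n=0..N. u m * u n * E (\<xi> m - \<xi> n))"
    using assms by (simp add: pos_def_def)
  also have "\<dots> = (\<Sum>m=0..N. \<Sum>n=0..N. u m * u n * (c * E (\<xi> m - \<xi> n)))"
    by (simp add: sum_distrib_left mult_ac)
  finally show "0 \<le> (\<Sum>m=0..N. \<Sum>n=0..N. u m * u n * (c * E (\<xi> m - \<xi> n)))" .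
qed

lemma pos_def_integral:
  assumes "\<And>t. has_bochner_integral M (\<lambda>x. f x t) (E t)" and "\<And>x. x \<in> space M \<Longrightarrow> pos_def (f x)"
  shows "pos_def E"
  unfolding pos_def_def
proof (intro allI)
  fix N and \<xi> u :: "nat \<Rightarrow> real"
  have "has_bochner_integral M (\<lambda>x. \<Sum>m=0..N. \<Sum>n=0..N. u m * u n * f x (\<xi> m - \<xi> n))
      (\<Sum>m=0..N. \<Sum>n=0..N. u m * u n * E (\<xi> m - \<xi> n))"
    by (intro has_bochner_integral_sum has_bochner_integral_mult_right assms(1))
  moreover have "0 \<le> (\<Sum>m=0..N. \<Sum>n=0..N. u m * u n * f x (\<xi> m - \<xi> n))" if "x \<in> space M" for x
    using assms(2)[OF that] by (simp add: pos_def_def)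
  ultimately show "0 \<le> (\<Sum>m=0..N. \<Sum>n=0..N. u m * u n * E (\<xi> m - \<xi> n))"
    by (metis (no_types, lifting) has_bochner_integral_iff Bochner_Integration.integral_nonneg)
qed

lemma pos_def_lim:
  assumes "\<And>n. pos_def (f n)" and "\<And>t. (\<lambda>n. f n t) \<longlonglongrightarrow> E t"
  shows "pos_def E"
  unfolding pos_def_def
proof (intro allI)
  fix N and \<xi> u :: "nat \<Rightarrow> real"
  have "(\<lambda>k. \<Sum>m=0..N. \<Sum>n=0..N. u m * u n * f k (\<xi> m - \<xi> n)) \<longlonglongrightarrow>
      (\<Sum>m=0..N. \<Sum>n=0..N. u m * u n * E (\<xi> m - \<xi> n))"
    by (intro tendsto_intros assms(2))
  then show "0 \<le> (\<Sum>m=0..N. \<Sum>n=0..N. u m * u n * E (\<xi> m - \<xi> n))"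
    by (rule LIMSEQ_le_const) (use assms(1) in \<open>auto simp: pos_def_def\<close>)
qed

text \<open>
  In the Fourier variable \<open>x\<close> dual to \<open>t\<close>, \<open>shift_avg s\<close> multiplies by \<open>(1 + s cos (2\<pi>x)) / 2\<close>:
  by \<open>cos\<^sup>2 (\<pi>x)\<close> for \<open>s = 1\<close> and by \<open>sin\<^sup>2 (\<pi>x)\<close> for \<open>s = -1\<close>.
\<close>

definition shift_avg :: "real \<Rightarrow> (real \<Rightarrow> real) \<Rightarrow> real \<Rightarrow> real" where
  "shift_avg s V t = V t / 2 + s / 4 * (V (t + 1) + V (t - 1))"

text \<open>\<open>kern w\<close> is a mixture of the cosines \<open>cos (2 pi x t)\<close> with
  weight \<open>2 exp (- w x)\<close> on \<open>x > 0\<close>. Averaging over shifts multiplies this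
  weight by \<open>(1 + s cos (2 pi x)) / 2\<close>, which stays nonnegative for
  \<open>\<bar>s\<bar> \<le> 1\<close>.\<close>

lemma pos_def_shift_avg_kern:
  assumes w: "w > 0" and s: "\<bar>s\<bar> \<le> 1"
  shows "pos_def (shift_avg s (kern w))"
proof (rule pos_def_integral[where M = lborel_pos
      and f = "\<lambda>x t. (exp (- (w * x)) * (1 + s * cos (2 * pi * x))) * cos (2 * pi * x * t)"])
  have k: "has_bochner_integral lborel_pos (\<lambda>x. 2 * (exp (- (w * x)) * cos (2 * pi * t * x))) (kern w t)" for t
    using has_bochner_integral_mult_right[OF laplace_cos[OF w, of "2 * pi * t"], of 2]
    by (simp add: kern_def power_mult_distrib)
  show "has_bochner_integral lborel_pos (\<lambda>x. (exp (- (w * x)) * (1 + s * cos (2 * pi * x))) * cos (2 * pi * x * t))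
      (shift_avg s (kern w) t)" for t
  proof -
    have "has_bochner_integral lborel_pos
      (\<lambda>x. 2 * (exp (- (w * x)) * cos (2 * pi * t * x)) / 2 +
        s / 4 * (2 * (exp (- (w * x)) * cos (2 * pi * (t + 1) * x)) + 2 * (exp (- (w * x)) * cos (2 * pi * (t - 1) * x))))
      (shift_avg s (kern w) t)"
      unfolding shift_avg_def
      by (intro has_bochner_integral_add has_bochner_integral_mult_right has_bochner_integral_divide_zero k)
    also have "(\<lambda>x. 2 * (exp (- (w * x)) * cos (2 * pi * t * x)) / 2 +
        s / 4 * (2 * (exp (- (w * x)) * cos (2 * pi * (t + 1) * x)) + 2 * (exp (- (w * x)) * cos (2 * pi * (t - 1) * x))))
      = (\<lambda>x. (exp (- (w * x)) * (1 + s * cos (2 * pi * x))) * cos (2 * pi * x * t))" (is "?l = ?r")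
    proof
      fix x
      have "cos (2 * pi * (t + 1) * x) + cos (2 * pi * (t - 1) * x) = 2 * cos (2 * pi * x) * cos (2 * pi * x * t)"
        by (simp add: ring_distribs cos_add cos_diff mult_ac)
      then have c: "cos (2 * pi * (t + 1) * x) = 2 * cos (2 * pi * x) * cos (2 * pi * x * t) - cos (2 * pi * (t - 1) * x)"
        by simp
      have c': "cos (2 * pi * t * x) = cos (2 * pi * x * t)" by (simp add: mult_ac)
      show "?l x = ?r x" unfolding c c' by (simp add: algebra_simps)
    qed
    finally show ?thesis .
  qed
  show "pos_def (\<lambda>t. (exp (- (w * x)) * (1 + s * cos (2 * pi * x))) * cos (2 * pi * x * t))" for x
  proof (intro pos_def_mult pos_def_cos mult_nonneg_nonneg)
    have "\<bar>s * cos (2 * pi * x)\<bar> \<le> 1 * 1"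
      unfolding abs_mult using s by (intro mult_mono) auto
    then show "0 \<le> 1 + s * cos (2 * pi * x)" by linarith
  qed simp
qed

text \<open>A second integral for the same kernel, now with decay governed by \<open>t\<close> and
  oscillation by \<open>w\<close>. Its integrand can be altered so as to change the values for
  \<open>\<bar>t\<bar> < 1\<close> only.\<close>

lemma kern_eq_laplace_sin:
  assumes "t \<noteq> 0"
  shows "has_bochner_integral lborel_pos (\<lambda>y. 2 * (exp (- (2 * pi * \<bar>t\<bar> * y)) * sin (w * y))) (kern w t)"
  using has_bochner_integral_mult_right[OF laplace_sin[of "2 * pi * \<bar>t\<bar>" w], of 2] assms
  by (simp add: kern_def power_mult_distrib add.commute)

text \<open>Since \<open>S\<close> is even and decreasing on the half-line,
  \<open>\<rho> w = S (w - l) - S (w + l)\<close> is nonnegative for \<open>w \<ge> 0\<close>, and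
  its sine transform is \<open>sin (l y) * T y\<close>. Inserting this transform into the integral
  over \<open>y\<close> and exchanging the integrations by means of
  \<open>kern_eq_laplace_sin\<close> exhibits the function as the mixture of the kernels
  \<open>kern w\<close> with weight \<open>\<rho> w\<close>, so its shift average is a positive
  mixture of positive definite functions.\<close>

lemma pos_def_of_even_antimono:
  fixes S T :: "real \<Rightarrow> real" and l s :: real
  assumes even: "\<And>x. S (- x) = S x" and int: "integrable lborel S"
    and anti: "\<And>x y. 0 \<le> x \<Longrightarrow> x \<le> y \<Longrightarrow> S y \<le> S x"
    and FT: "\<And>y. y > 0 \<Longrightarrow> (LINT w|lborel. S w * cos (w * y)) = T y"
    and l: "l > 0" and s: "\<bar>s\<bar> \<le> 1"
    and intT: "integrable lborel_pos (\<lambda>y. sin (l * y) * T y)"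
  shows "pos_def (shift_avg s (\<lambda>t. 2 * (LINT y|lborel_pos. exp (- (2 * pi * \<bar>t\<bar> * y)) * (sin (l * y) * T y))))"
proof -
  define V where "V t = 2 * (LINT y|lborel_pos. exp (- (2 * pi * \<bar>t\<bar> * y)) * (sin (l * y) * T y))" for t
  define \<rho> where "\<rho> w = S (w - l) - S (w + l)" for w
  have [measurable]: "S \<in> borel_measurable borel" using int by auto
  have [measurable]: "\<rho> \<in> borel_measurable borel" unfolding \<rho>_def by measurable
  \<comment> \<open>By evenness \<open>S\<close> may be evaluated at
    \<open>\<bar>w - l\<bar>\<close>, which is at most \<open>w + l\<close>.\<close>
  have \<rho>_nonneg: "\<rho> w \<ge> 0" if "w \<ge> 0" for w
  proof -
    have "S \<bar>w - l\<bar> = S (w - l)" using even[of "w - l"] by (simp add: abs_if)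
    then show ?thesis using anti[of "\<bar>w - l\<bar>" "w + l"] that l by (simp add: \<rho>_def)
  qed
  have shift: "integrable lborel (\<lambda>w. S (w + c) * f w)"
    if "\<And>w. \<bar>f w\<bar> \<le> 1" "f \<in> borel_measurable borel" for c and f :: "real \<Rightarrow> real"
  proof (rule Bochner_Integration.integrable_bound)
    show "integrable lborel (\<lambda>w. S (w + c))"
      using lborel_integrable_real_affine[OF int, of 1 c] by (simp add: add.commute)
    show "AE w in lborel. norm (S (w + c) * f w) \<le> norm (S (w + c))"
      using that(1) by (simp add: abs_mult mult_left_le)
  qed (use that in measurable)
  have int\<rho>: "integrable lborel \<rho>"
    using Bochner_Integration.integrable_diff[OF shift[of "\<lambda>_. 1" "- l"] shift[of "\<lambda>_. 1" l]]
    by (simp add: \<rho>_def[abs_def])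
  \<comment> \<open>After translation, \<open>sin ((w - c) y)\<close> is expanded; the sine
    transform of the even \<open>S\<close> vanishes and only its cosine transform \<open>T\<close>
    remains. As \<open>\<rho>\<close> is odd, the half-line integral is half of the full
    one.\<close>
  have sine: "(LINT w|lborel_pos. \<rho> w * sin (w * y)) = sin (l * y) * T y" if y: "y > 0" for y
  proof -
    have S: "(LINT w|lborel. S (w + c) * sin (w * y)) = - sin (c * y) * T y" for c
    proof -
      have "(LINT w|lborel. S (w + c) * sin (w * y)) = (LINT w|lborel. S w * sin ((w - c) * y))"
        using lborel_integral_real_affine[of 1 "\<lambda>w. S (w + c) * sin (w * y)" "- c"] by simp
      also have "(\<lambda>w. S w * sin ((w - c) * y)) = (\<lambda>w. cos (c * y) * (S w * sin (w * y)) - sin (c * y) * (S w * cos (w * y)))"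
        by (simp add: fun_eq_iff left_diff_distrib sin_diff algebra_simps)
      also have "integral\<^sup>L lborel \<dots> = cos (c * y) * (LINT w|lborel. S w * sin (w * y)) - sin (c * y) * (LINT w|lborel. S w * cos (w * y))"
        using shift[of "\<lambda>w. sin (w * y)" 0] shift[of "\<lambda>w. cos (w * y)" 0] by simp
      also have "(LINT w|lborel. S w * sin (w * y)) = 0"
        by (rule integral_lborel_odd) (simp add: even)
      finally show ?thesis using FT[OF y] by simp
    qed
    have I: "integrable lborel (\<lambda>w. S (w + c) * sin (w * y))" for c by (rule shift) auto
    have eq: "\<rho> w * sin (w * y) = S (w + (- l)) * sin (w * y) - S (w + l) * sin (w * y)" for w
      by (simp add: \<rho>_def left_diff_distrib)
    have ev: "\<rho> (- w) * sin (- w * y) = \<rho> w * sin (w * y)" for w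
    proof -
      have "S (- w - l) = S (w + l)" "S (- w + l) = S (w - l)"
        using even[of "w + l"] even[of "w - l"] by (simp_all only: minus_add_distrib minus_diff_eq diff_conv_add_uminus minus_minus add.commute)
      then show ?thesis by (simp add: \<rho>_def left_diff_distrib)
    qed
    have "2 * (LINT w|lborel_pos. \<rho> w * sin (w * y)) = (LINT w|lborel. \<rho> w * sin (w * y))"
    proof (rule integral_lborel_pos_even[symmetric])
      show "integrable lborel (\<lambda>w. \<rho> w * sin (w * y))"
        unfolding eq using I by (intro Bochner_Integration.integrable_diff)
    qed (rule ev)
    also have "\<dots> = 2 * (sin (l * y) * T y)"
      unfolding eq using I[of l] I[of "- l"] by (subst Bochner_Integration.integral_diff) (simp_all only: S, simp)
    finally show ?thesis by simp
  qed
  \<comment> \<open>Fubini: for \<open>t \<noteq> 0\<close> the integrand is dominated by a product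
    of an integrable function of \<open>w\<close> and an integrable exponential in
    \<open>y\<close>.\<close>
  have V: "has_bochner_integral lborel_pos (\<lambda>w. \<rho> w * kern w t) (V t)" if t: "t \<noteq> 0" for t
  proof -
    define f where "f w y = \<rho> w * (2 * (exp (- (2 * pi * \<bar>t\<bar> * y)) * sin (w * y)))" for w y
    have e: "integrable lborel_pos (\<lambda>y. 2 * exp (- (2 * pi * \<bar>t\<bar> * y)))"
      using integrable_power_exp_lborel_pos[of "2 * pi * \<bar>t\<bar>" 0] t by simp
    have [measurable]: "case_prod f \<in> borel_measurable (lborel_pos \<Otimes>\<^sub>M lborel_pos)"
      unfolding f_def by (intro borel_measurable_lborel_pos_pair) measurable
    have If: "integrable (lborel_pos \<Otimes>\<^sub>M lborel_pos) (case_prod f)"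
    proof (rule Bochner_Integration.integrable_bound)
      show "integrable (lborel_pos \<Otimes>\<^sub>M lborel_pos) (\<lambda>(w, y). \<rho> w * (2 * exp (- (2 * pi * \<bar>t\<bar> * y))))"
      proof (rule lborel_pos.Fubini_integrable)
        show "(\<lambda>(w, y). \<rho> w * (2 * exp (- (2 * pi * \<bar>t\<bar> * y)))) \<in> borel_measurable (lborel_pos \<Otimes>\<^sub>M lborel_pos)"
          by (intro borel_measurable_lborel_pos_pair) measurable
      qed (use e in \<open>auto simp: abs_mult intro!: integrable_lborel_pos_I integrable_mult_left integrable_abs int\<rho>\<close>)
      show "AE p in lborel_pos \<Otimes>\<^sub>M lborel_pos. norm (case_prod f p) \<le> norm (case p of (w, y) \<Rightarrow> \<rho> w * (2 * exp (- (2 * pi * \<bar>t\<bar> * y))))"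
        by (auto simp: f_def abs_mult split: prod.split intro!: AE_I2 mult_left_mono mult_left_le)
    qed simp
    have k: "(LINT y|lborel_pos. f w y) = \<rho> w * kern w t" for w
      using kern_eq_laplace_sin[OF t, of w] unfolding f_def
      by (simp add: has_bochner_integral_iff del: integral_mult_right_zero integral_mult_right)

    have "(LINT w|lborel_pos. f w y) = 2 * (exp (- (2 * pi * \<bar>t\<bar> * y)) * (sin (l * y) * T y))" if "y > 0" for y
    proof -
      have "(\<lambda>w. f w y) = (\<lambda>w. (2 * exp (- (2 * pi * \<bar>t\<bar> * y))) * (\<rho> w * sin (w * y)))"
        by (simp add: f_def fun_eq_iff)
      then show ?thesis using sine[OF that] by simp
    qed
    then have "(LINT y|lborel_pos. (LINT w|lborel_pos. f w y)) = V t"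
      unfolding V_def by (subst Bochner_Integration.integral_cong[OF refl]) auto
    then show ?thesis
      using lborel_pos.Fubini_integral[OF If] lborel_pos.integrable_fst[OF If]
      by (simp add: has_bochner_integral_iff k)
  qed
  \<comment> \<open>For \<open>t = 0\<close> the double integral does not converge absolutely, hence a limit \<open>t \<rightarrow> 0\<close>:
    monotone in \<open>w\<close>, dominated in \<open>y\<close>.\<close>
  have V0: "has_bochner_integral lborel_pos (\<lambda>w. \<rho> w * kern w 0) (V 0)"
  proof -
    define \<tau> where "\<tau> n = 1 / real (Suc n)" for n
    have \<tau>: "\<tau> n > 0" "\<tau> (Suc n) \<le> \<tau> n" for n by (simp_all add: \<tau>_def field_simps)
    have \<tau>lim: "\<tau> \<longlonglongrightarrow> 0" unfolding \<tau>_def by (rule LIMSEQ_Suc[OF lim_1_over_n])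
    show ?thesis
    proof (rule has_bochner_integral_monotone_convergence)
      show "integrable lborel_pos (\<lambda>w. \<rho> w * kern w (\<tau> n))" for n
        using V[of "\<tau> n"] \<tau>(1)[of n] by (auto simp: has_bochner_integral_iff)
      show "AE w in lborel_pos. mono (\<lambda>n. \<rho> w * kern w (\<tau> n))"
      proof (rule AE_I2)
        fix w assume "w \<in> space lborel_pos"
        then have w: "w > 0" by simp
        show "mono (\<lambda>n. \<rho> w * kern w (\<tau> n))"
        proof (rule incseq_SucI[unfolded mono_def[symmetric]])
          fix n
          have "kern w (\<tau> n) \<le> kern w (\<tau> (Suc n))"
            unfolding kern_def using w \<tau>[of n] \<tau>(1)[of "Suc n"]
            by (intro divide_left_mono add_left_mono mult_left_mono power_mono mult_pos_pos add_pos_nonneg) auto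
          then show "\<rho> w * kern w (\<tau> n) \<le> \<rho> w * kern w (\<tau> (Suc n))"
            using \<rho>_nonneg[of w] w by (intro mult_left_mono) auto
        qed
      qed
      show "AE w in lborel_pos. (\<lambda>n. \<rho> w * kern w (\<tau> n)) \<longlonglongrightarrow> \<rho> w * kern w 0"
      proof (rule AE_I2)
        fix w assume "w \<in> space lborel_pos"
        then show "(\<lambda>n. \<rho> w * kern w (\<tau> n)) \<longlonglongrightarrow> \<rho> w * kern w 0"
          unfolding kern_def by (intro tendsto_intros \<tau>lim) auto
      qed
      show "(\<lambda>n. LINT w|lborel_pos. \<rho> w * kern w (\<tau> n)) \<longlonglongrightarrow> V 0"
      proof -
        have "(LINT w|lborel_pos. \<rho> w * kern w (\<tau> n)) = V (\<tau> n)" for n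
          using V[of "\<tau> n"] \<tau>(1)[of n] by (auto simp: has_bochner_integral_iff)
        moreover have "(\<lambda>n. V (\<tau> n)) \<longlonglongrightarrow> V 0"
          unfolding V_def
        proof (intro tendsto_intros integral_dominated_convergence[where w = "\<lambda>y. \<bar>sin (l * y) * T y\<bar>"])
          show "AE y in lborel_pos. (\<lambda>n. exp (- (2 * pi * \<bar>\<tau> n\<bar> * y)) * (sin (l * y) * T y))
              \<longlonglongrightarrow> exp (- (2 * pi * \<bar>0\<bar> * y)) * (sin (l * y) * T y)"
            by (intro AE_I2 tendsto_intros \<tau>lim)
          show "AE y in lborel_pos. norm (exp (- (2 * pi * \<bar>\<tau> n\<bar> * y)) * (sin (l * y) * T y)) \<le> \<bar>sin (l * y) * T y\<bar>" for n
            by (rule AE_I2) (auto simp: abs_mult intro!: mult_left_le_one_le)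
        qed (use intT in \<open>auto intro!: borel_measurable_times borel_measurable_lborel_pos[of "\<lambda>y. exp (- (c * y))" for c] borel_measurable_integrable[OF intT]\<close>)
        ultimately show ?thesis by simp
      qed
      show "(\<lambda>w. \<rho> w * kern w 0) \<in> borel_measurable lborel_pos"
        unfolding kern_def by (intro borel_measurable_lborel_pos) measurable
    qed
  qed
  have Vall: "has_bochner_integral lborel_pos (\<lambda>w. \<rho> w * kern w t) (V t)" for t
    using V V0 by (cases "t = 0") auto
  have "pos_def (shift_avg s V)"
  proof (rule pos_def_integral[where M = lborel_pos and f = "\<lambda>w t. \<rho> w * shift_avg s (kern w) t"])
    show "has_bochner_integral lborel_pos (\<lambda>w. \<rho> w * shift_avg s (kern w) t) (shift_avg s V t)" for t
    proof -
      have "has_bochner_integral lborel_pos (\<lambda>w. \<rho> w * kern w t / 2 +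
          s / 4 * (\<rho> w * kern w (t + 1) + \<rho> w * kern w (t - 1))) (shift_avg s V t)"
        unfolding shift_avg_def
        by (intro has_bochner_integral_add has_bochner_integral_mult_right has_bochner_integral_divide_zero Vall)
      then show ?thesis by (simp add: shift_avg_def algebra_simps)
    qed
    show "pos_def (\<lambda>t. \<rho> w * shift_avg s (kern w) t)" if "w \<in> space lborel_pos" for w
      using that s \<rho>_nonneg[of w] by (intro pos_def_mult pos_def_shift_avg_kern) auto
  qed
  then show ?thesis by (simp only: V_def[abs_def])
qed

section \<open>Cosine and sine integrals\<close>

lemma summable_inverse_square_shift:
  fixes \<theta> :: real
  assumes "\<theta> > 0"
  shows "summable (\<lambda>k. 1 / (real k + \<theta>)\<^sup>2)"
  using Polygamma_converges'[of \<theta> 2] assms by (simp add: inverse_eq_divide add.commute)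

lemma sums_geometric_exp:
  fixes x \<theta> :: real
  assumes "x > 0"
  shows "(\<lambda>k. exp (- ((real k + \<theta>) * x))) sums (exp (- (\<theta> * x)) / (1 - exp (- x)))"
proof -
  have "(\<lambda>k. exp (- (\<theta> * x)) * exp (- x) ^ k) sums (exp (- (\<theta> * x)) * (1 / (1 - exp (- x))))"
    using assms by (intro sums_mult geometric_sums) simp
  moreover have "exp (- (\<theta> * x)) * exp (- x) ^ k = exp (- ((real k + \<theta>) * x))" for k
    by (simp add: algebra_simps flip: exp_of_nat_mult exp_add)
  ultimately show ?thesis by simp
qed

text \<open>Expansion of \<open>1 / (1 - exp (- w))\<close> into a geometric series and termwise
  integration by \<open>laplace_mult_cos\<close>; the exchange is justified by the convergence of
  the sum of \<open>1 / (k + \<theta>)^2\<close>. The case \<open>\<theta> = 1/2\<close> is the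
  weight \<open>(w/2) / sinh (w/2)\<close>, the case \<open>\<theta> = 1\<close> the weight
  \<open>w / (exp w - 1)\<close>.\<close>

lemma
  fixes \<theta> y :: real
  assumes \<theta>: "\<theta> > 0"
  shows integrable_cos_geometric:
      "integrable lborel_pos (\<lambda>w. w * exp (- (\<theta> * w)) / (1 - exp (- w)) * cos (w * y))"
    and integral_cos_geometric:
      "(\<lambda>k. ((real k + \<theta>)\<^sup>2 - y\<^sup>2) / ((real k + \<theta>)\<^sup>2 + y\<^sup>2)\<^sup>2) sums
        (LINT w|lborel_pos. w * exp (- (\<theta> * w)) / (1 - exp (- w)) * cos (w * y))"
proof -
  define f where "f k w = w * exp (- ((real k + \<theta>) * w)) * cos (y * w)" for k w
  have pos: "real k + \<theta> > 0" for k using \<theta> by simp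
  have f: "has_bochner_integral lborel_pos (f k) (((real k + \<theta>)\<^sup>2 - y\<^sup>2) / ((real k + \<theta>)\<^sup>2 + y\<^sup>2)\<^sup>2)" for k
    unfolding f_def using pos by (rule laplace_mult_cos)
  have g: "has_bochner_integral lborel_pos (\<lambda>w. w * exp (- ((real k + \<theta>) * w))) (1 / (real k + \<theta>)\<^sup>2)" for k
    using pos by (rule laplace_id)
  have sums: "(\<lambda>k. f k w) sums (w * exp (- (\<theta> * w)) / (1 - exp (- w)) * cos (w * y))" if "w > 0" for w
    using sums_mult[OF sums_geometric_exp[OF that, of \<theta>], of "w * cos (y * w)"]
    by (simp add: f_def mult_ac)
  have summ: "summable (\<lambda>k. norm (f k w))" if "w > 0" for w
  proof (rule summable_comparison_test')
    show "summable (\<lambda>k. w * exp (- ((real k + \<theta>) * w)))"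
      using sums_geometric_exp[OF that, of \<theta>] by (intro summable_mult) (auto simp: sums_iff)
    show "norm (norm (f k w)) \<le> w * exp (- ((real k + \<theta>) * w))" for k
      using that by (simp add: f_def abs_mult mult_left_le)
  qed
  have summi: "summable (\<lambda>k. LINT w|lborel_pos. norm (f k w))"
  proof (rule summable_comparison_test'[OF summable_inverse_square_shift[OF \<theta>]])
    fix k
    have "(LINT w|lborel_pos. norm (f k w)) \<le> (LINT w|lborel_pos. w * exp (- ((real k + \<theta>) * w)))"
    proof (rule integral_mono)
      show "norm (f k w) \<le> w * exp (- ((real k + \<theta>) * w))" if "w \<in> space lborel_pos" for w
        using that by (simp add: f_def abs_mult mult_left_le)
    qed (use f[of k] g[of k] in \<open>auto simp: has_bochner_integral_iff intro!: integrable_norm\<close>)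
    then show "norm (LINT w|lborel_pos. norm (f k w)) \<le> 1 / (real k + \<theta>)\<^sup>2"
      using g[of k] by (simp add: has_bochner_integral_iff abs_of_nonneg)
  qed
  have int: "integrable lborel_pos (f k)" for k using f by (simp add: has_bochner_integral_iff)
  have eq: "(\<Sum>k. f k w) = w * exp (- (\<theta> * w)) / (1 - exp (- w)) * cos (w * y)" if "w > 0" for w
    using sums[OF that] by (simp add: sums_iff)
  have "integrable lborel_pos (\<lambda>w. \<Sum>k. f k w)"
    by (rule integrable_suminf) (use int summ summi in auto)
  also have "?this \<longleftrightarrow> integrable lborel_pos (\<lambda>w. w * exp (- (\<theta> * w)) / (1 - exp (- w)) * cos (w * y))"
    by (rule Bochner_Integration.integrable_cong) (auto simp: eq)
  finally show "integrable lborel_pos (\<lambda>w. w * exp (- (\<theta> * w)) / (1 - exp (- w)) * cos (w * y))" .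
  have "(\<lambda>k. integral\<^sup>L lborel_pos (f k)) sums (LINT w|lborel_pos. (\<Sum>k. f k w))"
    by (rule sums_integral) (use int summ summi in auto)
  also have "(LINT w|lborel_pos. (\<Sum>k. f k w)) = (LINT w|lborel_pos. w * exp (- (\<theta> * w)) / (1 - exp (- w)) * cos (w * y))"
    by (rule Bochner_Integration.integral_cong) (auto simp: eq)
  finally show "(\<lambda>k. ((real k + \<theta>)\<^sup>2 - y\<^sup>2) / ((real k + \<theta>)\<^sup>2 + y\<^sup>2)\<^sup>2) sums
        (LINT w|lborel_pos. w * exp (- (\<theta> * w)) / (1 - exp (- w)) * cos (w * y))"
    using f by (simp add: has_bochner_integral_iff)
qed

text \<open>Geometric expansion and termwise integration again; the resulting series is that of
  \<open>coth_pfd\<close> at \<open>l / a\<close>.\<close>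

lemma integral_sin_over_exp_minus_1:
  fixes a l :: real
  assumes a: "a > 0" and l: "l > 0"
  shows "has_bochner_integral lborel_pos (\<lambda>y. sin (l * y) / (exp (a * y) - 1))
     ((pi * coth (pi * l / a) - a / l) / (2 * a))"
proof -
  define f where "f k y = exp (- (a * (real k + 1) * y)) * sin (l * y)" for k y
  have pos: "a * (real k + 1) > 0" for k using a by simp
  have f: "has_bochner_integral lborel_pos (f k) (l / ((a * (real k + 1))\<^sup>2 + l\<^sup>2))" for k
    unfolding f_def using pos by (rule laplace_sin)
  have g: "has_bochner_integral lborel_pos (\<lambda>y. l * (y * exp (- (a * (real k + 1) * y)))) (l * (1 / (a * (real k + 1))\<^sup>2))" for k
    by (intro has_bochner_integral_mult_right laplace_id pos)
  have geo: "(\<lambda>k. exp (- (a * (real k + 1) * y))) sums (1 / (exp (a * y) - 1))" if "y > 0" for y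
  proof -
    have "exp (- (a * y)) / (1 - exp (- (a * y))) = 1 / (exp (a * y) - 1)"
      using a that by (simp add: exp_minus divide_simps)
    then show ?thesis using sums_geometric_exp[of "a * y" 1] a that by (simp add: mult_ac)
  qed
  have sums: "(\<lambda>k. f k y) sums (sin (l * y) / (exp (a * y) - 1))" if "y > 0" for y
    using sums_mult[OF geo[OF that], of "sin (l * y)"] by (simp add: f_def mult_ac)
  have summ: "summable (\<lambda>k. norm (f k y))" if "y > 0" for y
  proof (rule summable_comparison_test')
    show "summable (\<lambda>k. exp (- (a * (real k + 1) * y)))"
      using geo[OF that] by (auto simp: sums_iff)
    show "norm (norm (f k y)) \<le> exp (- (a * (real k + 1) * y))" for k
      by (simp add: f_def abs_mult mult_left_le)
  qed
  \<comment> \<open>Bounding the sine by 1 would only give a harmonic series. The bound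
    \<open>\<bar>sin (l y)\<bar> \<le> l y\<close> gains the second power of
    \<open>k + 1\<close>.\<close>
  have summi: "summable (\<lambda>k. LINT y|lborel_pos. norm (f k y))"
  proof (rule summable_comparison_test')
    show "summable (\<lambda>k. l * (1 / (a * (real k + 1))\<^sup>2))"
      using summable_mult[OF summable_inverse_square_shift[of 1], of "l / a\<^sup>2"] by (simp add: power_mult_distrib)
    fix k
    have "(LINT y|lborel_pos. norm (f k y)) \<le> (LINT y|lborel_pos. l * (y * exp (- (a * (real k + 1) * y))))"
    proof (rule integral_mono)
      fix y assume "y \<in> space lborel_pos"
      then have "\<bar>sin (l * y)\<bar> \<le> l * y" using l abs_sin_x_le_abs_x[of "l * y"] by simp
      from mult_left_mono[OF this, of "exp (- (a * (real k + 1) * y))"]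
      show "norm (f k y) \<le> l * (y * exp (- (a * (real k + 1) * y)))"
        by (simp add: f_def abs_mult mult_ac)
    qed (use f[of k] g[of k] in \<open>auto simp: has_bochner_integral_iff intro!: integrable_norm\<close>)
    then show "norm (LINT y|lborel_pos. norm (f k y)) \<le> l * (1 / (a * (real k + 1))\<^sup>2)"
      using g[of k] by (simp add: has_bochner_integral_iff abs_of_nonneg)
  qed
  have int: "integrable lborel_pos (f k)" for k using f by (simp add: has_bochner_integral_iff)
  have eq: "(\<Sum>k. f k y) = sin (l * y) / (exp (a * y) - 1)" if "y > 0" for y
    using sums[OF that] by (simp add: sums_iff)
  have "integrable lborel_pos (\<lambda>y. \<Sum>k. f k y)"
    by (rule integrable_suminf) (use int summ summi in auto)
  also have "?this \<longleftrightarrow> integrable lborel_pos (\<lambda>y. sin (l * y) / (exp (a * y) - 1))"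
    by (rule Bochner_Integration.integrable_cong) (auto simp: eq)
  finally have I: "integrable lborel_pos (\<lambda>y. sin (l * y) / (exp (a * y) - 1))" .
  have "(\<lambda>k. integral\<^sup>L lborel_pos (f k)) sums (LINT y|lborel_pos. (\<Sum>k. f k y))"
    by (rule sums_integral) (use int summ summi in auto)
  also have "(LINT y|lborel_pos. (\<Sum>k. f k y)) = (LINT y|lborel_pos. sin (l * y) / (exp (a * y) - 1))"
    by (rule Bochner_Integration.integral_cong) (auto simp: eq)
  finally have 1: "(\<lambda>k. l / ((a * (real k + 1))\<^sup>2 + l\<^sup>2)) sums (LINT y|lborel_pos. sin (l * y) / (exp (a * y) - 1))"
    using f by (simp add: has_bochner_integral_iff)
  have "(\<lambda>k. 1 / (2 * a) * (2 * (l / a) / ((real k + 1)\<^sup>2 + (l / a)\<^sup>2))) sums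
      (1 / (2 * a) * (pi * cosh (pi * (l / a)) / sinh (pi * (l / a)) - 1 / (l / a)))"
    using a l by (intro sums_mult coth_pfd) simp
  also have "(\<lambda>k. 1 / (2 * a) * (2 * (l / a) / ((real k + 1)\<^sup>2 + (l / a)\<^sup>2))) = (\<lambda>k. l / ((a * (real k + 1))\<^sup>2 + l\<^sup>2))"
  proof
    fix k
    have "(a * c)\<^sup>2 + l\<^sup>2 = a\<^sup>2 * (c\<^sup>2 + (l / a)\<^sup>2)" for c
      using a by (simp add: power_mult_distrib power_divide distrib_left)
    from this[of "real k + 1"] show "1 / (2 * a) * (2 * (l / a) / ((real k + 1)\<^sup>2 + (l / a)\<^sup>2)) = l / ((a * (real k + 1))\<^sup>2 + l\<^sup>2)"
      using a by (simp add: power2_eq_square)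
  qed
  finally have "(LINT y|lborel_pos. sin (l * y) / (exp (a * y) - 1)) = (pi * coth (pi * l / a) - a / l) / (2 * a)"
    using 1 sums_unique2 by (fastforce simp: coth_def)
  then show ?thesis using I by (simp add: has_bochner_integral_iff)
qed

lemma coth_half: "x \<noteq> 0 \<Longrightarrow> coth (x / 2) = coth x + csch x"
  using sinh_double[of "x / 2"] cosh_double[of "x / 2"] cosh_square_eq[of "x / 2"]
  by (simp add: coth_def csch_def divide_simps power2_eq_square)

text \<open>With \<open>q = exp (2 pi y)\<close>,
  \<open>1 / (q + 1) = 1 / (q - 1) - 2 / (q^2 - 1)\<close>, so the previous integral at
  \<open>a = 2 pi\<close> and \<open>a = 4 pi\<close> suffices; \<open>coth_half\<close> turns the
  difference of the two hyperbolic cotangents into a \<open>csch\<close>.\<close>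

lemma integral_sin_over_exp_plus_1:
  fixes l :: real
  assumes l: "l > 0"
  shows "has_bochner_integral lborel_pos (\<lambda>y. sin (l * y) / (exp (2 * pi * y) + 1)) ((2 / l - csch (l / 2)) / 4)"
proof -
  have aux: "s / (q - 1) - 2 * (s / ((q - 1) * (q + 1))) = s / (q + 1)" if "q > 1" for q s :: real
  proof -
    have "s / (q - 1) - 2 * (s / ((q - 1) * (q + 1))) = (s * (q + 1) - 2 * s) / ((q - 1) * (q + 1))"
      using that by (simp add: diff_divide_distrib)
    also have "s * (q + 1) - 2 * s = s * (q - 1)" by (simp add: algebra_simps)
    finally show ?thesis using that by simp
  qed
  have "has_bochner_integral lborel_pos
      (\<lambda>y. sin (l * y) / (exp (2 * pi * y) - 1) - 2 * (sin (l * y) / (exp (4 * pi * y) - 1)))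
      ((pi * coth (pi * l / (2 * pi)) - 2 * pi / l) / (2 * (2 * pi)) -
       2 * ((pi * coth (pi * l / (4 * pi)) - 4 * pi / l) / (2 * (4 * pi))))"
    by (intro has_bochner_integral_diff has_bochner_integral_mult_right integral_sin_over_exp_minus_1 l) simp_all
  also have "?this \<longleftrightarrow> has_bochner_integral lborel_pos (\<lambda>y. sin (l * y) / (exp (2 * pi * y) + 1)) ((2 / l - csch (l / 2)) / 4)"
  proof (rule has_bochner_integral_cong)
    fix y assume "y \<in> space lborel_pos"
    then have E: "exp (2 * pi * y) > 1" by simp
    have "exp (4 * pi * y) - 1 = (exp (2 * pi * y) - 1) * (exp (2 * pi * y) + 1)"
      by (simp add: algebra_simps flip: exp_add)
    then show "sin (l * y) / (exp (2 * pi * y) - 1) - 2 * (sin (l * y) / (exp (4 * pi * y) - 1)) =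
        sin (l * y) / (exp (2 * pi * y) + 1)"
      using aux[OF E] by simp
  next
    have "coth (l / 4) = coth (l / 2) + csch (l / 2)"
      using coth_half[of "l / 2"] l by simp
    then show "(pi * coth (pi * l / (2 * pi)) - 2 * pi / l) / (2 * (2 * pi)) -
       2 * ((pi * coth (pi * l / (4 * pi)) - 4 * pi / l) / (2 * (4 * pi))) = (2 / l - csch (l / 2)) / 4"
      using l by (simp add: field_simps)
  qed simp
  finally show ?thesis .
qed

section \<open>Extremal interpolation of the kernel\<close>

lemma le_sinh_real: "0 \<le> x \<Longrightarrow> x \<le> sinh (x::real)"
proof -
  assume "0 \<le> x"
  then have "sinh 0 - 0 \<le> sinh x - x"
    by (rule DERIV_nonneg_imp_nondecreasing) (auto intro!: exI derivative_eq_intros simp: cosh_real_ge_1)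
  then show ?thesis by simp
qed

lemma sinh_le_mult_cosh: "0 \<le> x \<Longrightarrow> sinh x \<le> x * cosh (x::real)"
proof -
  assume "0 \<le> x"
  then have "0 * cosh 0 - sinh 0 \<le> x * cosh x - sinh x"
    by (rule DERIV_nonneg_imp_nondecreasing) (auto intro!: exI derivative_eq_intros)
  then show ?thesis by simp
qed

lemma divide_sinh_antimono:
  fixes x y :: real
  assumes "0 < x" "x \<le> y"
  shows "y / sinh y \<le> x / sinh x"
  using assms(2)
proof (rule DERIV_nonpos_imp_nonincreasing)
  fix z assume "x \<le> z"
  then have z: "z > 0" using assms by simp
  then have "((\<lambda>z. z / sinh z) has_real_derivative (sinh z - z * cosh z) / (sinh z * sinh z)) (at z)"
    by (auto intro!: derivative_eq_intros)
  moreover have "(sinh z - z * cosh z) / (sinh z * sinh z) \<le> 0"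
    using sinh_le_mult_cosh[of z] z by (intro divide_nonpos_nonneg) auto
  ultimately show "\<exists>d. ((\<lambda>z. z / sinh z) has_real_derivative d) (at z) \<and> d \<le> 0" by blast
qed

lemma shift_avg_laplace:
  assumes "integrable lborel_pos h"
  shows "shift_avg s (\<lambda>t. 2 * (LINT y|lborel_pos. exp (- (2 * pi * \<bar>t\<bar> * y)) * h y)) t =
      (LINT y|lborel_pos. (exp (- (2 * pi * \<bar>t\<bar> * y)) +
        s / 2 * (exp (- (2 * pi * \<bar>t + 1\<bar> * y)) + exp (- (2 * pi * \<bar>t - 1\<bar> * y)))) * h y)"
proof -
  define e where "e t y = exp (- (2 * pi * \<bar>t\<bar> * y))" for t y
  have I: "integrable lborel_pos (\<lambda>y. e t y * h y)" for t
  proof (rule Bochner_Integration.integrable_bound[OF assms])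
    show "AE y in lborel_pos. norm (e t y * h y) \<le> norm (h y)"
      by (rule AE_I2) (auto simp: e_def abs_mult intro!: mult_left_le_one_le)
    show "(\<lambda>y. e t y * h y) \<in> borel_measurable lborel_pos"
      unfolding e_def
      by (intro borel_measurable_times borel_measurable_lborel_pos[of "\<lambda>y. exp (- (2 * pi * \<bar>t\<bar> * y))"]
          borel_measurable_integrable[OF assms]) auto
  qed
  have "(LINT y|lborel_pos. (e t y + s / 2 * (e (t + 1) y + e (t - 1) y)) * h y) =
    (LINT y|lborel_pos. e t y * h y + (s / 2 * (e (t + 1) y * h y) + s / 2 * (e (t - 1) y * h y)))"
    by (rule Bochner_Integration.integral_cong) (simp_all add: algebra_simps)
  also have "\<dots> = (LINT y|lborel_pos. e t y * h y) + (s / 2 * (LINT y|lborel_pos. e (t + 1) y * h y) + s / 2 * (LINT y|lborel_pos. e (t - 1) y * h y))"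
    using I by simp
  finally have *: "(LINT y|lborel_pos. (e t y + s / 2 * (e (t + 1) y + e (t - 1) y)) * h y) = \<dots>" .
  have "shift_avg s (\<lambda>t. 2 * J t) t = J t + (s / 2 * J (t + 1) + s / 2 * J (t - 1))" for J
    by (simp add: shift_avg_def algebra_simps)
  from trans[OF this[of "\<lambda>t. LINT y|lborel_pos. e t y * h y"] *[symmetric]] show ?thesis
    unfolding e_def .
qed

text \<open>For \<open>\<bar>t\<bar> \<ge> 1\<close> the numbers \<open>\<bar>t + 1\<bar>\<close>
  and \<open>\<bar>t - 1\<bar>\<close> are \<open>\<bar>t\<bar> + 1\<close> and
  \<open>\<bar>t\<bar> - 1\<close> in some order. The factor \<open>1 + s cosh (2 pi y)\<close> is
  \<open>2 cosh^2 (pi y)\<close> for \<open>s = 1\<close> and \<open>- 2 sinh^2 (pi y)\<close> for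
  \<open>s = - 1\<close>.\<close>

lemma shifted_exp_sum:
  fixes s t y :: real
  assumes "\<bar>t\<bar> \<ge> 1"
  shows "exp (- (2 * pi * \<bar>t\<bar> * y)) + s / 2 * (exp (- (2 * pi * \<bar>t + 1\<bar> * y)) + exp (- (2 * pi * \<bar>t - 1\<bar> * y)))
     = exp (- (2 * pi * \<bar>t\<bar> * y)) * (1 + s * cosh (2 * pi * y))"
proof -
  have e: "exp (- (2 * pi * (\<bar>t\<bar> + 1) * y)) + exp (- (2 * pi * (\<bar>t\<bar> - 1) * y)) =
      exp (- (2 * pi * \<bar>t\<bar> * y)) * (2 * cosh (2 * pi * y))"
  proof -
    have "exp (- (2 * pi * (\<bar>t\<bar> + 1) * y)) = exp (- (2 * pi * \<bar>t\<bar> * y)) * exp (- (2 * pi * y))"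
      "exp (- (2 * pi * (\<bar>t\<bar> - 1) * y)) = exp (- (2 * pi * \<bar>t\<bar> * y)) * exp (2 * pi * y)"
      by (simp_all add: ring_distribs flip: exp_add)
    then show ?thesis by (simp add: cosh_field_def ring_distribs)
  qed
  have "exp (- (2 * pi * \<bar>t + 1\<bar> * y)) + exp (- (2 * pi * \<bar>t - 1\<bar> * y)) =
      exp (- (2 * pi * \<bar>t\<bar> * y)) * (2 * cosh (2 * pi * y))"
  proof (cases "t \<ge> 1")
    case True
    then have "\<bar>t + 1\<bar> = \<bar>t\<bar> + 1" "\<bar>t - 1\<bar> = \<bar>t\<bar> - 1" by auto
    then show ?thesis using e by simp
  next
    case False
    then have "\<bar>t + 1\<bar> = \<bar>t\<bar> - 1" "\<bar>t - 1\<bar> = \<bar>t\<bar> + 1" using assms by auto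
    then show ?thesis using e by simp
  qed
  then show ?thesis by (simp add: algebra_simps)
qed

text \<open>The construction with \<open>cosh\<close>, hence \<open>s = 1\<close>. The weight
  \<open>T\<close> cancels the factor \<open>2 cosh^2 (pi y)\<close> that shift averaging produces
  for \<open>\<bar>t\<bar> \<ge> 1\<close>, and \<open>S\<close> is the even decreasing function
  whose cosine transform is \<open>T\<close>, by \<open>sech_square_pfd\<close>. The value at 0 is
  then an explicit sine integral.\<close>

lemma pos_def_interpolant_lower:
  assumes l: "l > 0"
  obtains E where "pos_def E" "\<And>t. \<bar>t\<bar> \<ge> 1 \<Longrightarrow> E t = kern l t" "E 0 = 2 / l - csch (l / 2)"
proof -
  \<comment> \<open>The value 1 is the limit at 0; the default value 0 of the quotient would destroy
    monotonicity.\<close>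
  define R where "R w = (if w = 0 then 1 else (w / 2) / sinh (w / 2))" for w :: real
  define S where "S w = R w / pi\<^sup>2" for w
  define T where "T y = 1 / (cosh (pi * y))\<^sup>2" for y :: real
  \<comment> \<open>The form required by \<open>integral_cos_geometric\<close> at
    \<open>\<theta> = 1/2\<close>.\<close>
  have R: "R w = w * exp (- (1 / 2 * w)) / (1 - exp (- w))" if "w > 0" for w
  proof -
    have "exp (w / 2) * (1 - exp (- w)) = 2 * sinh (w / 2)"
      by (simp add: sinh_field_def algebra_simps flip: exp_add)
    then have "2 * sinh (w / 2) * exp (- (w / 2)) = 1 - exp (- w)"
      by (metis exp_minus_inverse mult.commute mult.left_commute mult_1)
    then show ?thesis using that by (simp add: R_def exp_minus divide_simps mult_ac)
  qed
  have int_cos: "integrable lborel_pos (\<lambda>w. R w * cos (w * y))" for y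
    using integrable_cos_geometric[of "1/2" y]
    by (rule Bochner_Integration.integrable_cong[THEN iffD1, OF refl, rotated]) (auto simp: R)
  have even: "R (- w) = R w" for w by (simp add: R_def)
  have FTR: "has_bochner_integral lborel_pos (\<lambda>w. R w * cos (w * y)) (pi\<^sup>2 / 2 * T y)" if "y > 0" for y
  proof -
    have "(LINT w|lborel_pos. R w * cos (w * y)) = (LINT w|lborel_pos. w * exp (- (1 / 2 * w)) / (1 - exp (- w)) * cos (w * y))"
      by (rule Bochner_Integration.integral_cong) (auto simp: R)
    then have "(\<lambda>k. ((real k + 1/2)\<^sup>2 - y\<^sup>2) / ((real k + 1/2)\<^sup>2 + y\<^sup>2)\<^sup>2) sums (LINT w|lborel_pos. R w * cos (w * y))"
      using integral_cos_geometric[of "1/2" y] by simp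
    then have "(\<lambda>k. 2 * ((real k + 1/2)\<^sup>2 - y\<^sup>2) / ((real k + 1/2)\<^sup>2 + y\<^sup>2)\<^sup>2) sums (2 * (LINT w|lborel_pos. R w * cos (w * y)))"
      by (auto dest: sums_mult[where c = 2])
    then have "2 * (LINT w|lborel_pos. R w * cos (w * y)) = pi\<^sup>2 * T y"
      using sech_square_pfd[of y] that sums_unique2 by (fastforce simp: T_def)
    then show ?thesis using int_cos by (simp add: has_bochner_integral_iff)
  qed
  have FT: "(LINT w|lborel. S w * cos (w * y)) = T y" if "y > 0" for y
  proof -
    have "has_bochner_integral lborel (\<lambda>w. R w * cos (w * y)) (2 * (pi\<^sup>2 / 2 * T y))"
      using FTR[OF that] by (rule has_bochner_integral_even) (simp add: even)
    then have "(LINT w|lborel. R w * cos (w * y)) = pi\<^sup>2 * T y" by (simp add: has_bochner_integral_iff)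
    moreover have "(LINT w|lborel. S w * cos (w * y)) = (LINT w|lborel. R w * cos (w * y)) / pi\<^sup>2"
      by (simp add: S_def)
    ultimately show ?thesis by simp
  qed
  have "has_bochner_integral lborel_pos R (integral\<^sup>L lborel_pos R)"
    using int_cos[of 0] by (simp add: has_bochner_integral_iff)
  from has_bochner_integral_even[OF this even] have intS: "integrable lborel S"
    unfolding S_def by (intro integrable_divide) (simp add: has_bochner_integral_iff)
  have anti: "S y \<le> S x" if "0 \<le> x" "x \<le> y" for x y
  proof -
    have "R y \<le> R x"
    proof (cases "x = 0")
      case True
      then show ?thesis using that le_sinh_real[of "y / 2"] by (auto simp: R_def divide_le_eq)
    next
      case False
      then show ?thesis using that divide_sinh_antimono[of "x / 2" "y / 2"] by (simp add: R_def)
    qed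
    then show ?thesis by (simp add: S_def divide_right_mono)
  qed
  have Tle: "\<bar>T y\<bar> \<le> 4 * exp (- (2 * pi * y))" for y
  proof -
    have "exp (pi * y) \<le> 2 * cosh (pi * y)" by (simp add: cosh_field_def)
    then have "(exp (pi * y))\<^sup>2 \<le> (2 * cosh (pi * y))\<^sup>2" by (rule power_mono) simp
    then have "exp (2 * pi * y) \<le> 4 * (cosh (pi * y))\<^sup>2"
      by (simp add: power_mult_distrib power2_eq_square[of "exp (pi * y)"] mult.assoc flip: exp_add)
    then show ?thesis by (simp add: T_def exp_minus field_simps)
  qed
  have [measurable]: "T \<in> borel_measurable borel"
    unfolding T_def by (intro borel_measurable_continuous_onI continuous_intros) auto
  have intT: "integrable lborel_pos (\<lambda>y. sin (l * y) * T y)"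
  proof (rule Bochner_Integration.integrable_bound)
    show "integrable lborel_pos (\<lambda>y. 4 * exp (- (2 * pi * y)))"
      using integrable_power_exp_lborel_pos[of "2 * pi" 0] by simp
    show "AE y in lborel_pos. norm (sin (l * y) * T y) \<le> norm (4 * exp (- (2 * pi * y)))"
    proof (rule AE_I2)
      fix y
      have "\<bar>sin (l * y)\<bar> * \<bar>T y\<bar> \<le> \<bar>T y\<bar>" by (intro mult_left_le_one_le) auto
      also note Tle
      finally show "norm (sin (l * y) * T y) \<le> norm (4 * exp (- (2 * pi * y)))" by (simp add: abs_mult)
    qed
  qed (intro borel_measurable_lborel_pos, measurable)
  define E where "E = shift_avg 1 (\<lambda>t. 2 * (LINT y|lborel_pos. exp (- (2 * pi * \<bar>t\<bar> * y)) * (sin (l * y) * T y)))"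
  have E: "E t = (LINT y|lborel_pos. (exp (- (2 * pi * \<bar>t\<bar> * y)) + 1 / 2 * (exp (- (2 * pi * \<bar>t + 1\<bar> * y)) + exp (- (2 * pi * \<bar>t - 1\<bar> * y))))
      * (sin (l * y) * T y))" for t
    unfolding E_def using intT by (rule shift_avg_laplace)
  show thesis
  proof (rule that[of E])
    show "pos_def E"
      unfolding E_def
      by (rule pos_def_of_even_antimono[where S = S]) (use even intS anti FT l intT in \<open>auto simp: S_def\<close>)
    show "E t = kern l t" if t: "\<bar>t\<bar> \<ge> 1" for t
    proof -
      have "E t = (LINT y|lborel_pos. 2 * (exp (- (2 * pi * \<bar>t\<bar> * y)) * sin (l * y)))"
        unfolding E
      proof (rule Bochner_Integration.integral_cong[OF refl])
        fix y
        have "1 + cosh (2 * pi * y) = 2 * (cosh (pi * y))\<^sup>2"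
          using cosh_double[of "pi * y"] cosh_square_eq[of "pi * y"] by (simp add: mult_ac)
        then show "(exp (- (2 * pi * \<bar>t\<bar> * y)) + 1 / 2 * (exp (- (2 * pi * \<bar>t + 1\<bar> * y)) + exp (- (2 * pi * \<bar>t - 1\<bar> * y)))) * (sin (l * y) * T y)
            = 2 * (exp (- (2 * pi * \<bar>t\<bar> * y)) * sin (l * y))"
          using shifted_exp_sum[OF t, of y 1] by (simp add: T_def)
      qed
      then show ?thesis
        using kern_eq_laplace_sin[of t l] t by (auto simp only: has_bochner_integral_iff)
    qed
    show "E 0 = 2 / l - csch (l / 2)"
    proof -
      have "E 0 = (LINT y|lborel_pos. 4 * (sin (l * y) / (exp (2 * pi * y) + 1)))"
        unfolding E
      proof (rule Bochner_Integration.integral_cong[OF refl])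
        fix y
        \<comment> \<open>At \<open>t = 0\<close> the bracket is
          \<open>1 + exp (- 2 pi y) = 1 + 1 / q^2\<close>, and its product with \<open>T y\<close>
          collapses to \<open>4 / (q^2 + 1)\<close>.\<close>
        define q where "q = exp (pi * y)"
        have q: "q > 0" by (simp add: q_def)
        have T: "T y = 4 / (q + 1 / q)\<^sup>2"
          by (simp add: T_def q_def cosh_field_def exp_minus inverse_eq_divide power_divide)
        have e1: "exp (2 * pi * y) = q\<^sup>2" "exp (- (2 * pi * y)) = 1 / q\<^sup>2"
          by (simp_all add: q_def power2_eq_square exp_minus inverse_eq_divide mult_ac flip: exp_add)
        have eqs: "q + 1 / q = (q\<^sup>2 + 1) / q" "1 + 1 / q\<^sup>2 = (q\<^sup>2 + 1) / q\<^sup>2"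
          using q by (simp_all add: field_simps power2_eq_square)
        have A: "(A / q\<^sup>2) * (4 / (A / q)\<^sup>2) = 4 / A" if "A > 0" for A
          using that q by (simp add: power_divide power2_eq_square)
        have "(1 + 1 / q\<^sup>2) * (4 / (q + 1 / q)\<^sup>2) = 4 / (q\<^sup>2 + 1)"
          unfolding eqs by (rule A) (simp add: add_nonneg_pos)
        then have "(1 + 1 / q\<^sup>2) * (c * (4 / (q + 1 / q)\<^sup>2)) = 4 * (c / (q\<^sup>2 + 1))" for c
          by (metis mult.assoc mult.commute times_divide_eq_right)
        then show "(exp (- (2 * pi * \<bar>0\<bar> * y)) + 1 / 2 * (exp (- (2 * pi * \<bar>0 + 1\<bar> * y)) + exp (- (2 * pi * \<bar>0 - 1\<bar> * y)))) * (sin (l * y) * T y)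
            = 4 * (sin (l * y) / (exp (2 * pi * y) + 1))"
          unfolding T e1(1) by (simp add: e1(2))
      qed
      then show ?thesis
        using has_bochner_integral_integral_eq[OF has_bochner_integral_mult_right[OF integral_sin_over_exp_plus_1[OF l], of 4]]
        by (metis (no_types, lifting) nonzero_mult_div_cancel_left times_divide_eq_right zero_neq_numeral)
    qed
  qed
qed

section \<open>The regularised construction for the upper bound\<close>

lemma square_le_sinh_square: "(x::real)\<^sup>2 \<le> (sinh x)\<^sup>2"
proof -
  have "\<bar>x\<bar> \<le> \<bar>sinh x\<bar>" using le_sinh_real[of "\<bar>x\<bar>"] by simp
  then show ?thesis by (simp add: abs_le_square_iff)
qed

text \<open>
  After division by \<open>exp c\<close>, the difference \<open>f\<close> of the two sides vanishes to third order at \<open>0\<close>;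
  its second derivative is \<open>exp (-c)\<close> times an increasing function \<open>h\<close>.
\<close>

lemma exp_regularised_ineq:
  fixes c e :: real
  assumes c: "c \<ge> 0" and e: "0 < e" "e \<le> 1/10"
  shows "2 * (c * exp c - exp c + 1) \<le> exp (- (e * c)) * (exp c - 1)\<^sup>2"
proof -
  define h where "h c = (1 - e)\<^sup>2 * exp ((2 - e) * c) - 2 * e\<^sup>2 * exp ((1 - e) * c) + (1 + e)\<^sup>2 * exp (- (e * c)) - 2" for c
  define f2 where "f2 c = (1 - e)\<^sup>2 * exp ((1 - e) * c) - 2 * e\<^sup>2 * exp (- (e * c)) + (1 + e)\<^sup>2 * exp (- ((1 + e) * c)) - 2 * exp (- c)" for c
  define f1 where "f1 c = (1 - e) * exp ((1 - e) * c) + 2 * e * exp (- (e * c)) - (1 + e) * exp (- ((1 + e) * c)) - 2 + 2 * exp (- c)" for c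
  define f where "f c = exp ((1 - e) * c) - 2 * exp (- (e * c)) + exp (- ((1 + e) * c)) - 2 * c + 2 - 2 * exp (- c)" for c
  have h: "h c \<ge> 0" if "c \<ge> 0" for c
  proof -
    have "h 0 \<le> h c"
      using that
    proof (rule DERIV_nonneg_imp_nondecreasing)
      fix x :: real assume x: "0 \<le> x"
      have "(h has_real_derivative ((1 - e)\<^sup>2 * (2 - e) * exp ((2 - e) * x) - 2 * e\<^sup>2 * (1 - e) * exp ((1 - e) * x) - e * (1 + e)\<^sup>2 * exp (- (e * x)))) (at x)"
        unfolding h_def by (auto intro!: derivative_eq_intros)
      moreover have "0 \<le> (1 - e)\<^sup>2 * (2 - e) * exp ((2 - e) * x) - 2 * e\<^sup>2 * (1 - e) * exp ((1 - e) * x) - e * (1 + e)\<^sup>2 * exp (- (e * x))"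
      proof -
        define X where "X = exp ((2 - e) * x)"
        have "X \<ge> 1" using e x by (simp add: X_def)
        have 1: "exp ((1 - e) * x) \<le> X" using e x unfolding X_def by (simp add: mult_right_mono)
        have 2: "exp (- (e * x)) \<le> X" using e x mult_right_mono[of "- e" "2 - e" x] unfolding X_def by simp
        \<comment> \<open>For \<open>e \<le> 1/10\<close> the positive coefficient is at least
          1.539, while the two subtracted ones are at most 0.02 and 0.121. Since \<open>X\<close> is
          the largest of the three exponentials, the positive term dominates.\<close>
        have "(81/100) * (19/10) \<le> (1 - e)\<^sup>2 * (2 - e)"
        proof (rule mult_mono)
          have "(9/10)\<^sup>2 \<le> (1 - e)\<^sup>2" using e by (intro power_mono) auto
          then show "81/100 \<le> (1 - e)\<^sup>2" by (simp add: power2_eq_square)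
        qed (use e in auto)
        moreover have "2 * e\<^sup>2 * (1 - e) \<le> 2 * (1/100) * 1"
        proof (rule mult_mono)
          have "e\<^sup>2 \<le> (1/10)\<^sup>2" using e by (intro power_mono) auto
          then show "2 * e\<^sup>2 \<le> 2 * (1/100)" by (simp add: power2_eq_square)
        qed (use e in auto)
        moreover have "e * (1 + e)\<^sup>2 \<le> (1/10) * (121/100)"
        proof (rule mult_mono)
          have "(1 + e)\<^sup>2 \<le> (11/10)\<^sup>2" using e by (intro power_mono) auto
          then show "(1 + e)\<^sup>2 \<le> 121/100" by (simp add: power2_eq_square)
        qed (use e in auto)
        ultimately have c: "0 \<le> (1 - e)\<^sup>2 * (2 - e) - 2 * e\<^sup>2 * (1 - e) - e * (1 + e)\<^sup>2" by linarith
        have "2 * e\<^sup>2 * (1 - e) * exp ((1 - e) * x) \<le> 2 * e\<^sup>2 * (1 - e) * X"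
          using 1 e by (intro mult_left_mono) auto
        moreover have "e * (1 + e)\<^sup>2 * exp (- (e * x)) \<le> e * (1 + e)\<^sup>2 * X"
          using 2 e by (intro mult_left_mono) auto
        moreover have "0 \<le> ((1 - e)\<^sup>2 * (2 - e) - 2 * e\<^sup>2 * (1 - e) - e * (1 + e)\<^sup>2) * X"
          using c \<open>X \<ge> 1\<close> by simp
        ultimately show ?thesis unfolding X_def[symmetric] by (simp add: algebra_simps)
      qed
      ultimately show "\<exists>d. (h has_real_derivative d) (at x) \<and> 0 \<le> d" by blast
    qed
    moreover have "h 0 = 0" by (simp add: h_def power2_eq_square algebra_simps)
    ultimately show ?thesis by simp
  qed
  have f2: "f2 c \<ge> 0" if "c \<ge> 0" for c
  proof -
    have "f2 c = exp (- c) * h c"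
    proof -
      have "exp (- c) * exp ((2 - e) * c) = exp ((1 - e) * c)" "exp (- c) * exp ((1 - e) * c) = exp (- (e * c))"
        "exp (- c) * exp (- (e * c)) = exp (- ((1 + e) * c))"
        by (simp_all add: algebra_simps flip: exp_add)
      moreover have "exp (- c) * h c = (1 - e)\<^sup>2 * (exp (- c) * exp ((2 - e) * c)) - 2 * e\<^sup>2 * (exp (- c) * exp ((1 - e) * c))
          + (1 + e)\<^sup>2 * (exp (- c) * exp (- (e * c))) - 2 * exp (- c)"
        unfolding h_def by (simp only: ring_distribs mult_ac)
      ultimately show ?thesis by (simp add: f2_def)
    qed
    then show ?thesis using h[OF that] by simp
  qed
  have f1: "f1 c \<ge> 0" if "c \<ge> 0" for c
  proof -
    have "(f1 has_real_derivative f2 x) (at x)" for x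
      unfolding f1_def f2_def by (auto intro!: derivative_eq_intros simp: power2_eq_square algebra_simps)
    then have "f1 0 \<le> f1 c"
      using f2 that by (intro DERIV_nonneg_imp_nondecreasing[where f = f1]) auto
    then show ?thesis by (simp add: f1_def)
  qed
  have "(f has_real_derivative f1 x) (at x)" for x
    unfolding f_def f1_def by (auto intro!: derivative_eq_intros simp: algebra_simps)
  then have "f 0 \<le> f c"
    using f1 c by (intro DERIV_nonneg_imp_nondecreasing[where f = f]) auto
  then have "0 \<le> exp c * f c" by (simp add: f_def)
  also have "exp c * f c = exp (- (e * c)) * (exp c - 1)\<^sup>2 - 2 * (c * exp c - exp c + 1)"
  proof -
    have "exp ((1 - e) * c) = exp c * exp (- (e * c))" "exp (- ((1 + e) * c)) = exp (- (e * c)) * exp (- c)"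
      by (simp_all add: algebra_simps flip: exp_add)
    moreover have "exp c * exp (- c) = 1" by (simp flip: exp_add)
    ultimately show ?thesis
      unfolding f_def power2_eq_square by (simp only:) algebra
  qed
  finally show ?thesis by simp
qed

text \<open>The derivative is nonpositive by \<open>exp_regularised_ineq\<close> at
  \<open>c = z\<close>, divided by \<open>2 (exp z - 1)^2\<close>.\<close>

lemma regularised_antimono:
  fixes e x y :: real
  assumes e: "0 < e" "e \<le> 1/10" and x: "0 < x" "x \<le> y"
  shows "exp (- (e * y)) / (2 * e) - y / (exp y - 1) \<le> exp (- (e * x)) / (2 * e) - x / (exp x - 1)"
  using x(2)
proof (rule DERIV_nonpos_imp_nonincreasing)
  fix z assume "x \<le> z"
  then have z: "z > 0" "exp z - 1 > 0" using x by auto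
  have "((\<lambda>z. exp (- (e * z)) / (2 * e) - z / (exp z - 1)) has_real_derivative
      - exp (- (e * z)) / 2 - ((exp z - 1) - z * exp z) / ((exp z - 1) * (exp z - 1))) (at z)"
    using e z by (auto intro!: derivative_eq_intros)
  moreover have "- exp (- (e * z)) / 2 - ((exp z - 1) - z * exp z) / ((exp z - 1) * (exp z - 1)) \<le> 0"
  proof -
    have "(z * exp z - exp z + 1) / (exp z - 1)\<^sup>2 \<le> exp (- (e * z)) / 2"
      using exp_regularised_ineq[of z e] z e by (simp add: divide_le_eq)
    moreover have "((exp z - 1) - z * exp z) / ((exp z - 1) * (exp z - 1)) = - ((z * exp z - exp z + 1) / (exp z - 1)\<^sup>2)"
      by (simp add: power2_eq_square minus_divide_left)
    ultimately show ?thesis by simp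
  qed
  ultimately show "\<exists>d. ((\<lambda>z. exp (- (e * z)) / (2 * e) - z / (exp z - 1)) has_real_derivative d) (at z) \<and> d \<le> 0" by blast
qed

lemma integrable_inverse_1_plus_square_lborel_pos: "integrable lborel_pos (\<lambda>y. 1 / (1 + y\<^sup>2))"
proof (rule integrable_lborel_pos_I)
  show "integrable lborel (\<lambda>y::real. 1 / (1 + y\<^sup>2))"
    using integrable_inverse_1_plus_square by (simp add: set_integrable_def inverse_eq_divide)
qed

lemma abs_exp_minus_diff_le:
  fixes a b :: real
  assumes "a \<ge> 0" "b \<ge> 0"
  shows "\<bar>exp (- a) - exp (- b)\<bar> \<le> \<bar>a - b\<bar>"
proof -
  have *: "exp (- a) - exp (- b) \<le> b - a" if "0 \<le> a" "a \<le> b" for a b :: real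
  proof -
    have "1 - exp (- (b - a)) \<le> b - a" using exp_ge_add_one_self[of "- (b - a)"] by linarith
    then have "exp (- a) * (1 - exp (- (b - a))) \<le> 1 * (b - a)"
      using that by (intro mult_mono) auto
    then show ?thesis by (simp add: algebra_simps flip: exp_add)
  qed
  then show ?thesis using *[of a b] *[of b a] assms by (cases "a \<le> b") auto
qed

text \<open>The construction with \<open>sinh\<close>, hence \<open>s = - 1\<close>. Now the weight
  \<open>T0\<close> behaves like \<open>1 / (pi y)^2\<close> at 0, so
  \<open>sin (l y) * T0 y\<close> is not integrable there and
  \<open>pos_def_of_even_antimono\<close> does not apply to it. It is applied to regularised weights
  \<open>T e\<close>, and the positive definite functions \<open>GE e\<close> converge to
  \<open>G\<close> as \<open>e\<close> tends to 0.\<close>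

lemma pos_def_interpolant_upper:
  assumes l: "l > 0"
  obtains G where "pos_def G" "\<And>t. \<bar>t\<bar> \<ge> 1 \<Longrightarrow> G t = - kern l t" "G 0 = coth (l / 2) - 2 / l"
proof -
  define Q where "Q w = \<bar>w\<bar> / (exp \<bar>w\<bar> - 1)" for w :: real
  \<comment> \<open>The transform of \<open>- \<bar>w\<bar> / 2 * coth (\<bar>w\<bar> / 2) = - \<bar>w\<bar> / 2 - Q w\<close> is formally \<open>\<pi>\<^sup>2 * T0\<close>;
    replacing \<open>- \<bar>w\<bar> / 2\<close> by \<open>(exp (- e\<bar>w\<bar>) - 1) / (2e)\<close> and dropping the constant makes it integrable.\<close>
  define S where "S e w = (exp (- (e * \<bar>w\<bar>)) / (2 * e) - Q w) / pi\<^sup>2" for e w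
  define T0 where "T0 y = 1 / (sinh (pi * y))\<^sup>2" for y :: real
  \<comment> \<open>This is \<open>T0\<close> with its singular part \<open>1 / (pi y)^2\<close>
    replaced by \<open>1 / (pi^2 (e^2 + y^2))\<close>; it is the cosine transform of
    \<open>S e\<close>.\<close>
  define T where "T e y = (1 / (e\<^sup>2 + y\<^sup>2) - (1 / y\<^sup>2 - pi\<^sup>2 * T0 y)) / pi\<^sup>2" for e y
  \<comment> \<open>The bracket of \<open>shift_avg_laplace\<close> for \<open>s = - 1\<close>. It
    vanishes at \<open>y = 0\<close>, which makes the integral defining \<open>G\<close> converge
    although \<open>T0\<close> is singular.\<close>
  define H where "H t y = exp (- (2 * pi * \<bar>t\<bar> * y)) +
      (- 1) / 2 * (exp (- (2 * pi * \<bar>t + 1\<bar> * y)) + exp (- (2 * pi * \<bar>t - 1\<bar> * y)))" for t y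
  define G where "G t = (LINT y|lborel_pos. H t y * (sin (l * y) * T0 y))" for t
  define GE where "GE e = shift_avg (- 1) (\<lambda>t. 2 * (LINT y|lborel_pos. exp (- (2 * pi * \<bar>t\<bar> * y)) * (sin (l * y) * T e y)))" for e
  have Q: "Q w = w * exp (- (1 * w)) / (1 - exp (- w))" if "w > 0" for w
    using that by (simp add: Q_def exp_minus divide_simps)
  have intQ: "integrable lborel_pos (\<lambda>w. Q w * cos (w * y))" for y
    using integrable_cos_geometric[of 1 y]
    by (rule Bochner_Integration.integrable_cong[THEN iffD1, OF refl, rotated]) (auto simp: Q)
  have FTQ: "has_bochner_integral lborel_pos (\<lambda>w. Q w * cos (w * y)) ((1 / y\<^sup>2 - pi\<^sup>2 * T0 y) / 2)" if "y > 0" for y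
  proof -
    have "(LINT w|lborel_pos. Q w * cos (w * y)) = (LINT w|lborel_pos. w * exp (- (1 * w)) / (1 - exp (- w)) * cos (w * y))"
      by (rule Bochner_Integration.integral_cong) (auto simp: Q)
    then have "(\<lambda>k. ((real k + 1)\<^sup>2 - y\<^sup>2) / ((real k + 1)\<^sup>2 + y\<^sup>2)\<^sup>2) sums (LINT w|lborel_pos. Q w * cos (w * y))"
      using integral_cos_geometric[of 1 y] by simp
    then have "(\<lambda>k. 2 * ((real k + 1)\<^sup>2 - y\<^sup>2) / ((real k + 1)\<^sup>2 + y\<^sup>2)\<^sup>2) sums (2 * (LINT w|lborel_pos. Q w * cos (w * y)))"
      by (auto dest: sums_mult[where c = 2])
    then have "2 * (LINT w|lborel_pos. Q w * cos (w * y)) = 1 / y\<^sup>2 - pi\<^sup>2 * T0 y"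
      using csch_square_pfd[of y] that sums_unique2 by (fastforce simp: T0_def)
    then show ?thesis using intQ by (simp add: has_bochner_integral_iff)
  qed
  have T0_le: "0 \<le> pi\<^sup>2 * T0 y" "pi\<^sup>2 * T0 y \<le> 1 / y\<^sup>2" if "y > 0" for y
  proof -
    show "0 \<le> pi\<^sup>2 * T0 y" by (simp add: T0_def)
    have "pi\<^sup>2 * y\<^sup>2 \<le> (sinh (pi * y))\<^sup>2" using square_le_sinh_square[of "pi * y"] by (simp add: power_mult_distrib)
    moreover have "0 < (sinh (pi * y))\<^sup>2" "0 < y\<^sup>2" using that by auto
    ultimately show "pi\<^sup>2 * T0 y \<le> 1 / y\<^sup>2" by (simp add: T0_def divide_simps)
  qed
  have T_le: "\<bar>T e y\<bar> \<le> 1 / (pi\<^sup>2 * y\<^sup>2)" if "y > 0" for e y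
  proof -
    have "0 \<le> 1 / (e\<^sup>2 + y\<^sup>2)" "1 / (e\<^sup>2 + y\<^sup>2) \<le> 1 / y\<^sup>2"
      using that by (auto intro!: divide_left_mono mult_pos_pos add_nonneg_pos)
    then have "\<bar>1 / (e\<^sup>2 + y\<^sup>2) - (1 / y\<^sup>2 - pi\<^sup>2 * T0 y)\<bar> \<le> 1 / y\<^sup>2"
      using T0_le[OF that] by linarith
    from divide_right_mono[OF this, of "pi\<^sup>2"] show ?thesis by (simp add: T_def abs_divide mult.commute)
  qed
  have [measurable]: "T0 \<in> borel_measurable borel"
  proof -
    have "sinh \<in> borel_measurable (borel :: real measure)"
      by (intro borel_measurable_continuous_onI continuous_intros)
    then show ?thesis unfolding T0_def by measurable
  qed
  have [measurable]: "T e \<in> borel_measurable borel" for e unfolding T_def by measurable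
  have [measurable]: "H t \<in> borel_measurable borel" for t unfolding H_def by measurable
  have pd: "pos_def (GE e)" and GE: "GE e t = (LINT y|lborel_pos. H t y * (sin (l * y) * T e y))"
    if e: "0 < e" "e \<le> 1/10" for e t
  proof -
    have even: "S e (- w) = S e w" for w by (simp add: S_def Q_def)
    have S_cos: "has_bochner_integral lborel_pos (\<lambda>w. S e w * cos (w * y)) (T e y / 2)" if "y > 0" for y
    proof -
      have "has_bochner_integral lborel_pos (\<lambda>w. (exp (- (e * w)) * cos (y * w) / (2 * e) - Q w * cos (w * y)) / pi\<^sup>2)
          ((e / (e\<^sup>2 + y\<^sup>2) / (2 * e) - (1 / y\<^sup>2 - pi\<^sup>2 * T0 y) / 2) / pi\<^sup>2)"
        using e that by (intro has_bochner_integral_divide_zero has_bochner_integral_diff laplace_cos FTQ)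
      also have "?this \<longleftrightarrow> has_bochner_integral lborel_pos (\<lambda>w. S e w * cos (w * y)) (T e y / 2)"
        by (rule has_bochner_integral_cong) (use e in \<open>auto simp: S_def T_def diff_divide_distrib left_diff_distrib right_diff_distrib mult_ac\<close>)
      finally show ?thesis .
    qed
    have FT: "(LINT w|lborel. S e w * cos (w * y)) = T e y" if "y > 0" for y
      using has_bochner_integral_even[OF S_cos[OF that]] even by (simp add: has_bochner_integral_iff)
    have intS: "integrable lborel (S e)"
    proof -
      have "integrable lborel_pos (\<lambda>w. (exp (- (e * w)) / (2 * e) - Q w) / pi\<^sup>2)"
        using integrable_power_exp_lborel_pos[OF e(1), of 0] intQ[of 0]
        by (intro integrable_divide Bochner_Integration.integrable_diff) simp_all
      also have "?this \<longleftrightarrow> integrable lborel_pos (S e)"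
        by (rule Bochner_Integration.integrable_cong) (auto simp: S_def)
      finally have "has_bochner_integral lborel_pos (S e) (integral\<^sup>L lborel_pos (S e))"
        by (simp add: has_bochner_integral_iff)
      from has_bochner_integral_even[OF this even] show ?thesis by (simp add: has_bochner_integral_iff)
    qed
    have anti: "S e y \<le> S e x" if "0 \<le> x" "x \<le> y" for x y
    proof (cases "x = 0")
      case True
      \<comment> \<open>Division by zero gives \<open>Q 0 = 0\<close>, whereas \<open>Q\<close>
        tends to 1 at 0. The value \<open>S e 0\<close> thus lies above the limit of
        \<open>S e\<close>, which is compatible with monotonicity.\<close>
      have "exp (- (e * y)) / (2 * e) \<le> 1 / (2 * e)" using e that by (intro divide_right_mono) auto
      moreover have "0 \<le> Q y" by (simp add: Q_def)
      ultimately have "exp (- (e * y)) / (2 * e) - Q y \<le> 1 / (2 * e)" by linarith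
      from divide_right_mono[OF this, of "pi\<^sup>2"] show ?thesis using True that by (simp add: S_def Q_def[of 0])
    next
      case False
      then show ?thesis
        using regularised_antimono[OF e, of x y] that by (auto simp: S_def Q_def intro!: divide_right_mono)
    qed
    \<comment> \<open>As the transform of an integrable function \<open>T e\<close> is bounded; this
      controls it near 0, where \<open>T_le\<close> is useless, while \<open>T_le\<close> gives the
      decay at infinity.\<close>
    define C where "C = (LINT w|lborel. \<bar>S e w\<bar>)"
    have TC: "\<bar>T e y\<bar> \<le> C" if "y > 0" for y
    proof -
      have "\<bar>LINT w|lborel. S e w * cos (w * y)\<bar> \<le> (LINT w|lborel. \<bar>S e w * cos (w * y)\<bar>)"
        by (rule integral_abs_bound)
      also have "\<dots> \<le> C"
        unfolding C_def
      proof (rule integral_mono')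
        show "integrable lborel (\<lambda>w. \<bar>S e w\<bar>)" using intS by simp
      qed (auto simp: abs_mult mult_left_le)
      finally show ?thesis using FT[OF that] by simp
    qed
    have intT: "integrable lborel_pos (\<lambda>y. sin (l * y) * T e y)"
    proof (rule Bochner_Integration.integrable_bound)
      show "integrable lborel_pos (\<lambda>y. (C + 1 / pi\<^sup>2) * (1 / (1 + y\<^sup>2)))"
        by (intro integrable_mult_right integrable_inverse_1_plus_square_lborel_pos)
      show "AE y in lborel_pos. norm (sin (l * y) * T e y) \<le> norm ((C + 1 / pi\<^sup>2) * (1 / (1 + y\<^sup>2)))"
      proof (rule AE_I2)
        fix y assume "y \<in> space lborel_pos"
        then have y: "y > 0" by simp
        have "\<bar>T e y\<bar> * y\<^sup>2 \<le> 1 / (pi\<^sup>2 * y\<^sup>2) * y\<^sup>2" by (intro mult_right_mono T_le y) simp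
        then have "\<bar>T e y\<bar> * (1 + y\<^sup>2) \<le> C + 1 / pi\<^sup>2" using TC[OF y] y by (simp add: distrib_left)
        then have "\<bar>T e y\<bar> \<le> (C + 1 / pi\<^sup>2) * (1 / (1 + y\<^sup>2))" by (simp add: le_divide_eq add_pos_nonneg)
        moreover have "\<bar>sin (l * y)\<bar> * \<bar>T e y\<bar> \<le> \<bar>T e y\<bar>" by (intro mult_left_le_one_le) auto
        ultimately show "norm (sin (l * y) * T e y) \<le> norm ((C + 1 / pi\<^sup>2) * (1 / (1 + y\<^sup>2)))"
          using abs_ge_self[of "(C + 1 / pi\<^sup>2) * (1 / (1 + y\<^sup>2))"]
          unfolding real_norm_def abs_mult[of "sin (l * y)"] by linarith
      qed
    qed (intro borel_measurable_lborel_pos, measurable)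
    show "pos_def (GE e)"
      unfolding GE_def
      by (rule pos_def_of_even_antimono[where S = "S e"]) (use even intS anti FT l intT in auto)
    show "GE e t = (LINT y|lborel_pos. H t y * (sin (l * y) * T e y))"
      unfolding GE_def H_def using intT by (rule shift_avg_laplace)
  qed
  \<comment> \<open>The offset 10 keeps the parameter within the range
    \<open>e \<le> 1/10\<close>.\<close>
  define \<tau> where "\<tau> n = 1 / real (n + 10)" for n
  have \<tau>: "0 < \<tau> n" "\<tau> n \<le> 1/10" for n by (auto simp: \<tau>_def divide_simps)
  have \<tau>lim: "\<tau> \<longlonglongrightarrow> 0" unfolding \<tau>_def by (rule LIMSEQ_ignore_initial_segment[OF lim_1_over_n])
  have lim: "(\<lambda>n. GE (\<tau> n) t) \<longlonglongrightarrow> G t" for t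
    unfolding GE[OF \<tau>] G_def
  \<comment> \<open>The two summands of the constant cover two ranges. For \<open>y \<le> 1\<close>
    the bounds \<open>\<bar>H t y\<bar> \<le> 2 pi y\<close>,
    \<open>\<bar>sin (l y)\<bar> \<le> l y\<close> and \<open>T_le\<close> give
    \<open>2 l / pi\<close>, doubled by \<open>1 + y^2 \<le> 2\<close>. For \<open>y > 1\<close> the
    first two factors are at most 1, and \<open>1 + y^2 \<le> 2 y^2\<close>.\<close>
  proof (rule integral_dominated_convergence[where w = "\<lambda>y. (4 * l / pi + 2 / pi\<^sup>2) * (1 / (1 + y\<^sup>2))"])
    show "AE y in lborel_pos. (\<lambda>n. H t y * (sin (l * y) * T (\<tau> n) y)) \<longlonglongrightarrow> H t y * (sin (l * y) * T0 y)"
    proof (rule AE_I2)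
      fix y assume "y \<in> space lborel_pos"
      then have y: "y > 0" by simp
      have "(\<lambda>n. T (\<tau> n) y) \<longlonglongrightarrow> (1 / (0\<^sup>2 + y\<^sup>2) - (1 / y\<^sup>2 - pi\<^sup>2 * T0 y)) / pi\<^sup>2"
        unfolding T_def using y by (intro tendsto_intros \<tau>lim) auto
      then show "(\<lambda>n. H t y * (sin (l * y) * T (\<tau> n) y)) \<longlonglongrightarrow> H t y * (sin (l * y) * T0 y)"
        by (intro tendsto_intros) simp
    qed
    show "AE y in lborel_pos. norm (H t y * (sin (l * y) * T (\<tau> n) y)) \<le> (4 * l / pi + 2 / pi\<^sup>2) * (1 / (1 + y\<^sup>2))" for n
    proof (rule AE_I2)
      fix y assume "y \<in> space lborel_pos"
      then have y: "y > 0" by simp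
      define E where "E t = exp (- (2 * pi * \<bar>t\<bar> * y))" for t
      have E: "0 \<le> E t" "E t \<le> 1" for t using y by (auto simp: E_def)
      have HE: "H t y = (E t - E (t + 1)) / 2 + (E t - E (t - 1)) / 2" by (simp add: H_def E_def field_simps)
      have D: "\<bar>E t - E s\<bar> \<le> 2 * pi * y" if "\<bar>\<bar>t\<bar> - \<bar>s\<bar>\<bar> \<le> 1" for s
      proof -
        have "\<bar>E t - E s\<bar> \<le> \<bar>2 * pi * \<bar>t\<bar> * y - 2 * pi * \<bar>s\<bar> * y\<bar>"
          unfolding E_def using y by (intro abs_exp_minus_diff_le) auto
        also have "2 * pi * \<bar>t\<bar> * y - 2 * pi * \<bar>s\<bar> * y = 2 * pi * y * (\<bar>t\<bar> - \<bar>s\<bar>)"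
          by (simp add: algebra_simps)
        also have "\<bar>2 * pi * y * (\<bar>t\<bar> - \<bar>s\<bar>)\<bar> = 2 * pi * y * \<bar>\<bar>t\<bar> - \<bar>s\<bar>\<bar>"
          using y by (simp add: abs_mult)
        also have "\<dots> \<le> 2 * pi * y * 1" using that y by (intro mult_left_mono) auto
        finally show ?thesis by simp
      qed
      have avg: "\<bar>a / 2 + b / 2\<bar> \<le> c" if "\<bar>a\<bar> \<le> c" "\<bar>b\<bar> \<le> c" for a b c :: real
        using that by (simp add: abs_le_iff field_simps)
      have D0: "\<bar>\<bar>t\<bar> - \<bar>t + 1\<bar>\<bar> \<le> 1" "\<bar>\<bar>t\<bar> - \<bar>t - 1\<bar>\<bar> \<le> 1" by linarith+
      have H1: "\<bar>H t y\<bar> \<le> 2 * pi * y"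
        unfolding HE by (intro avg D D0)
      have H2: "\<bar>H t y\<bar> \<le> 1"
        unfolding HE
      proof (rule avg)
        show "\<bar>E t - E (t + 1)\<bar> \<le> 1" "\<bar>E t - E (t - 1)\<bar> \<le> 1"
          using E[of t] E[of "t + 1"] E[of "t - 1"] unfolding abs_le_iff by linarith+
      qed
      have s: "\<bar>sin (l * y)\<bar> \<le> l * y" "\<bar>sin (l * y)\<bar> \<le> 1"
        using abs_sin_x_le_abs_x[of "l * y"] l y by auto
      define X where "X = \<bar>H t y\<bar> * (\<bar>sin (l * y)\<bar> * \<bar>T (\<tau> n) y\<bar>)"
      have X: "X * (1 + y\<^sup>2) \<le> 4 * l / pi + 2 / pi\<^sup>2"
      proof (cases "y \<le> 1")
        case True
        have "X \<le> 2 * pi * y * (l * y * (1 / (pi\<^sup>2 * y\<^sup>2)))"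
          unfolding X_def using H1 s T_le[OF y] y l by (intro mult_mono) auto
        also have "\<dots> = 2 * l / pi" using y by (simp add: power2_eq_square)
        finally have "X * (1 + y\<^sup>2) \<le> 2 * l / pi * 2"
          using True y l by (intro mult_mono) (auto simp: power_le_one)
        also have "\<dots> \<le> 4 * l / pi + 2 / pi\<^sup>2" by simp
        finally show ?thesis .
      next
        case False
        have "X \<le> 1 * (1 * (1 / (pi\<^sup>2 * y\<^sup>2)))"
          unfolding X_def using H2 s T_le[OF y] y by (intro mult_mono) auto
        then have "X * (1 + y\<^sup>2) \<le> 1 / (pi\<^sup>2 * y\<^sup>2) * (1 + y\<^sup>2)" by (intro mult_right_mono) auto
        also have "\<dots> \<le> 1 / (pi\<^sup>2 * y\<^sup>2) * (2 * y\<^sup>2)"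
          using False by (intro mult_left_mono) auto
        also have "\<dots> = 2 / pi\<^sup>2" using y by simp
        also have "\<dots> \<le> 4 * l / pi + 2 / pi\<^sup>2" using l by simp
        finally show ?thesis .
      qed
      have "norm (H t y * (sin (l * y) * T (\<tau> n) y)) = X" by (simp add: X_def abs_mult)
      also have "\<dots> \<le> (4 * l / pi + 2 / pi\<^sup>2) * (1 / (1 + y\<^sup>2))"
        using X by (simp add: le_divide_eq add_pos_nonneg)
      finally show "norm (H t y * (sin (l * y) * T (\<tau> n) y)) \<le> (4 * l / pi + 2 / pi\<^sup>2) * (1 / (1 + y\<^sup>2))" .
    qed
    show "integrable lborel_pos (\<lambda>y. (4 * l / pi + 2 / pi\<^sup>2) * (1 / (1 + y\<^sup>2)))"
      by (intro integrable_mult_right integrable_inverse_1_plus_square_lborel_pos)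
  qed (intro borel_measurable_lborel_pos, measurable)+
  show thesis
  proof (rule that[of G])
    show "pos_def G" using pd[OF \<tau>] lim by (rule pos_def_lim)
    show "G t = - kern l t" if t: "\<bar>t\<bar> \<ge> 1" for t
    proof -
      have "G t = (LINT y|lborel_pos. - (2 * (exp (- (2 * pi * \<bar>t\<bar> * y)) * sin (l * y))))"
        unfolding G_def
      proof (rule Bochner_Integration.integral_cong[OF refl])
        fix y assume "y \<in> space lborel_pos"
        then have "sinh (pi * y) \<noteq> 0" by simp
        moreover have "1 + (- 1) * cosh (2 * pi * y) = - 2 * (sinh (pi * y))\<^sup>2"
          using cosh_double[of "pi * y"] cosh_square_eq[of "pi * y"] by (simp add: mult_ac)
        ultimately show "H t y * (sin (l * y) * T0 y) = - (2 * (exp (- (2 * pi * \<bar>t\<bar> * y)) * sin (l * y)))"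
          unfolding H_def shifted_exp_sum[OF t, of y "- 1"] by (simp add: T0_def)
      qed
      then show ?thesis
        using kern_eq_laplace_sin[of t l] t by (auto simp only: has_bochner_integral_iff integral_minus)
    qed
    show "G 0 = coth (l / 2) - 2 / l"
    proof -
      have "G 0 = (LINT y|lborel_pos. 4 * (sin (l * y) / (exp (2 * pi * y) - 1)))"
        unfolding G_def
      proof (rule Bochner_Integration.integral_cong[OF refl])
        fix y assume "y \<in> space lborel_pos"
        \<comment> \<open>At \<open>t = 0\<close> the bracket is \<open>1 - 1 / q^2\<close>, and its
          product with \<open>T0 y\<close> is \<open>4 / (q^2 - 1)\<close>.\<close>
        define q where "q = exp (pi * y)"
        have q: "q > 1" using \<open>y \<in> space lborel_pos\<close> by (simp add: q_def)
        have T: "T0 y = 4 / (q - 1 / q)\<^sup>2"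
          by (simp add: T0_def q_def sinh_field_def exp_minus inverse_eq_divide power_divide)
        have e1: "exp (2 * pi * y) = q\<^sup>2" "exp (- (2 * pi * y)) = 1 / q\<^sup>2"
          by (simp_all add: q_def power2_eq_square exp_minus inverse_eq_divide mult_ac flip: exp_add)
        have eqs: "q - 1 / q = (q\<^sup>2 - 1) / q" "1 - 1 / q\<^sup>2 = (q\<^sup>2 - 1) / q\<^sup>2"
          using q by (simp_all add: field_simps power2_eq_square)
        have A: "(A / q\<^sup>2) * (4 / (A / q)\<^sup>2) = 4 / A" if "A > 0" for A
          using that q by (simp add: power_divide power2_eq_square)
        have "(1 - 1 / q\<^sup>2) * (4 / (q - 1 / q)\<^sup>2) = 4 / (q\<^sup>2 - 1)"
          unfolding eqs by (rule A) (use q in simp)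
        then have "(1 - 1 / q\<^sup>2) * (c * (4 / (q - 1 / q)\<^sup>2)) = 4 * (c / (q\<^sup>2 - 1))" for c
          by (metis mult.assoc mult.commute times_divide_eq_right)
        moreover have "H 0 y = 1 - 1 / q\<^sup>2" using e1(2) by (simp add: H_def)
        ultimately show "H 0 y * (sin (l * y) * T0 y) = 4 * (sin (l * y) / (exp (2 * pi * y) - 1))"
          unfolding T e1(1) by simp
      qed
      also have "\<dots> = 4 * ((pi * coth (pi * l / (2 * pi)) - 2 * pi / l) / (2 * (2 * pi)))"
        by (intro has_bochner_integral_integral_eq has_bochner_integral_mult_right integral_sin_over_exp_minus_1 l) simp
      also have "\<dots> = coth (l / 2) - 2 / l" by (simp add: field_simps)
      finally show ?thesis .
    qed
  qed
qed

section \<open>Point masses\<close>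

text \<open>The kernel is a parameter, so that bounds for \<open>kern x\<close> can be integrated to
  bounds for \<open>r_kernel \<mu>\<close>.\<close>

definition offdiag_form :: "nat \<Rightarrow> (nat \<Rightarrow> real) \<Rightarrow> (nat \<Rightarrow> real) \<Rightarrow> (real \<Rightarrow> real) \<Rightarrow> real" where
  "offdiag_form N \<xi> u c = (\<Sum>m=0..N. \<Sum>n\<in>{0..N} - {m}. u m * u n * c (\<xi> m - \<xi> n))"

text \<open>The integrand of \<open>A_const\<close>: the sharp constant for a unit point mass at
  \<open>x\<close>.\<close>

definition A_density :: "real \<Rightarrow> real \<Rightarrow> real" where
  "A_density \<delta> x = 2 / x - 1 / \<delta> * csch (x / (2 * \<delta>))"

definition B_density :: "real \<Rightarrow> real \<Rightarrow> real" where
  "B_density \<delta> x = 1 / \<delta> * coth (x / (2 * \<delta>)) - 2 / x"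

text \<open>The full form of \<open>E\<close> is nonnegative. Its diagonal contributes
  \<open>E 0\<close> times the sum of squares, and by separation the remaining terms only see
  arguments where \<open>E\<close> agrees with \<open>c\<close>.\<close>

lemma offdiag_form_pos_def:
  assumes "pos_def E" "separated 1 N \<xi>" "\<And>t. \<bar>t\<bar> \<ge> 1 \<Longrightarrow> E t = c t"
  shows "- E 0 * (\<Sum>n=0..N. (u n)\<^sup>2) \<le> offdiag_form N \<xi> u c"
proof -
  have "0 \<le> (\<Sum>m=0..N. \<Sum>n=0..N. u m * u n * E (\<xi> m - \<xi> n))"
    using assms(1) by (simp add: pos_def_def)
  also have "\<dots> = (\<Sum>m=0..N. (u m)\<^sup>2 * E 0 + (\<Sum>n\<in>{0..N} - {m}. u m * u n * c (\<xi> m - \<xi> n)))"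
  proof (rule sum.cong[OF refl])
    fix m assume m: "m \<in> {0..N}"
    have "(\<Sum>n=0..N. u m * u n * E (\<xi> m - \<xi> n)) =
        u m * u m * E (\<xi> m - \<xi> m) + (\<Sum>n\<in>{0..N} - {m}. u m * u n * E (\<xi> m - \<xi> n))"
      using m by (intro sum.remove) auto
    also have "(\<Sum>n\<in>{0..N} - {m}. u m * u n * E (\<xi> m - \<xi> n)) = (\<Sum>n\<in>{0..N} - {m}. u m * u n * c (\<xi> m - \<xi> n))"
    proof (rule sum.cong[OF refl])
      fix n assume "n \<in> {0..N} - {m}"
      then have "\<bar>\<xi> m - \<xi> n\<bar> \<ge> 1" using assms(2) m by (auto simp: separated_def)
      then show "u m * u n * E (\<xi> m - \<xi> n) = u m * u n * c (\<xi> m - \<xi> n)" using assms(3) by simp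
    qed
    finally show "(\<Sum>n=0..N. u m * u n * E (\<xi> m - \<xi> n)) =
        (u m)\<^sup>2 * E 0 + (\<Sum>n\<in>{0..N} - {m}. u m * u n * c (\<xi> m - \<xi> n))"
      by (simp add: power2_eq_square)
  qed
  also have "\<dots> = E 0 * (\<Sum>n=0..N. (u n)\<^sup>2) + offdiag_form N \<xi> u c"
    by (simp add: offdiag_form_def sum.distrib sum_distrib_left mult.commute)
  finally show ?thesis by simp
qed

lemma offdiag_form_scale:
  "offdiag_form N \<xi> u (\<lambda>t. r * c t) = r * offdiag_form N \<xi> u c"
  by (simp add: offdiag_form_def sum_distrib_left mult_ac)

lemma kern_scale:
  assumes "\<delta> > 0"
  shows "kern x t = 1 / \<delta> * kern (x / \<delta>) (t / \<delta>)"
proof -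
  have "(x / \<delta>)\<^sup>2 + 4 * pi\<^sup>2 * (t / \<delta>)\<^sup>2 = (x\<^sup>2 + 4 * pi\<^sup>2 * t\<^sup>2) / \<delta>\<^sup>2"
    by (simp add: power_divide add_divide_distrib)
  then show ?thesis using assms by (simp add: kern_def power2_eq_square)
qed

text \<open>Dividing the points by \<open>\<delta>\<close> reduces to separation 1 and mass point
  \<open>l = x / \<delta>\<close>; the densities are \<open>1 / \<delta>\<close> times the values at
  0 of the interpolants. The upper bound comes from interpolating \<open>- kern l\<close>.\<close>

lemma offdiag_form_kern_bounds:
  assumes \<delta>: "\<delta> > 0" and x: "x > 0" and sep: "separated \<delta> N \<xi>"
  shows "- A_density \<delta> x * (\<Sum>n=0..N. (u n)\<^sup>2) \<le> offdiag_form N \<xi> u (kern x)"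
    and "offdiag_form N \<xi> u (kern x) \<le> B_density \<delta> x * (\<Sum>n=0..N. (u n)\<^sup>2)"
proof -
  define l where "l = x / \<delta>"
  define \<eta> where "\<eta> n = \<xi> n / \<delta>" for n
  have l: "l > 0" using \<delta> x by (simp add: l_def)
  have sep1: "separated 1 N \<eta>"
    using sep \<delta> by (auto simp: separated_def \<eta>_def abs_divide le_divide_eq simp flip: diff_divide_distrib)
  have form: "offdiag_form N \<xi> u (kern x) = 1 / \<delta> * offdiag_form N \<eta> u (kern l)"
    unfolding offdiag_form_scale[symmetric]
    by (simp add: offdiag_form_def \<eta>_def l_def kern_scale[OF \<delta>, of x] diff_divide_distrib)
  obtain E where E: "pos_def E" "\<And>t. \<bar>t\<bar> \<ge> 1 \<Longrightarrow> E t = kern l t" "E 0 = 2 / l - csch (l / 2)"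
    using pos_def_interpolant_lower[OF l] by blast
  have "- E 0 * (\<Sum>n=0..N. (u n)\<^sup>2) \<le> offdiag_form N \<eta> u (kern l)"
    by (rule offdiag_form_pos_def[OF E(1) sep1 E(2)])
  from mult_left_mono[OF this, of "1 / \<delta>"] \<delta>
  have "1 / \<delta> * (- E 0 * (\<Sum>n=0..N. (u n)\<^sup>2)) \<le> offdiag_form N \<xi> u (kern x)" by (simp add: form)
  moreover have "1 / \<delta> * (- E 0 * s) = - A_density \<delta> x * s" for s
    using \<delta> x by (simp add: E(3) l_def A_density_def field_simps)
  ultimately show "- A_density \<delta> x * (\<Sum>n=0..N. (u n)\<^sup>2) \<le> offdiag_form N \<xi> u (kern x)" by simp
  obtain G where G: "pos_def G" "\<And>t. \<bar>t\<bar> \<ge> 1 \<Longrightarrow> G t = - kern l t" "G 0 = coth (l / 2) - 2 / l"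
    using pos_def_interpolant_upper[OF l] by blast
  have "- G 0 * (\<Sum>n=0..N. (u n)\<^sup>2) \<le> offdiag_form N \<eta> u (\<lambda>t. - 1 * kern l t)"
    by (rule offdiag_form_pos_def[OF G(1) sep1]) (simp add: G(2))
  then have "offdiag_form N \<eta> u (kern l) \<le> G 0 * (\<Sum>n=0..N. (u n)\<^sup>2)"
    unfolding offdiag_form_scale by simp
  from mult_left_mono[OF this, of "1 / \<delta>"] \<delta>
  have "offdiag_form N \<xi> u (kern x) \<le> 1 / \<delta> * (G 0 * (\<Sum>n=0..N. (u n)\<^sup>2))" by (simp add: form)
  moreover have "1 / \<delta> * (G 0 * s) = B_density \<delta> x * s" for s
    using \<delta> x by (simp add: G(3) l_def B_density_def field_simps)
  ultimately show "offdiag_form N \<xi> u (kern x) \<le> B_density \<delta> x * (\<Sum>n=0..N. (u n)\<^sup>2)" by simp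
qed

section \<open>Series for the two densities, and bounds derived from them\<close>

text \<open>\<open>coth_pfd\<close> at \<open>y = x / (2 pi \<delta>)\<close>, multiplied by
  \<open>1 / (pi \<delta>)\<close>. The sum runs over the differences in an arithmetic progression
  of step \<open>\<delta>\<close>, counted with both signs.\<close>

lemma kern_sums_B:
  assumes \<delta>: "\<delta> > 0" and x: "x > 0"
  shows "(\<lambda>k. 2 * kern x (\<delta> * (real k + 1))) sums B_density \<delta> x"
proof -
  define y where "y = x / (2 * pi * \<delta>)"
  have y: "y > 0" using \<delta> x by (simp add: y_def)
  have "(\<lambda>k. 1 / (pi * \<delta>) * (2 * y / ((real k + 1)\<^sup>2 + y\<^sup>2))) sums
      (1 / (pi * \<delta>) * (pi * cosh (pi * y) / sinh (pi * y) - 1 / y))"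
    using y by (intro sums_mult coth_pfd) simp
  also have "1 / (pi * \<delta>) * (pi * cosh (pi * y) / sinh (pi * y) - 1 / y) = B_density \<delta> x"
    using \<delta> x by (simp add: B_density_def coth_def y_def right_diff_distrib)
  also have "(\<lambda>k. 1 / (pi * \<delta>) * (2 * y / ((real k + 1)\<^sup>2 + y\<^sup>2))) = (\<lambda>k. 2 * kern x (\<delta> * (real k + 1)))"
  proof
    fix k
    have "x\<^sup>2 + 4 * pi\<^sup>2 * (\<delta> * c)\<^sup>2 = (2 * pi * \<delta>)\<^sup>2 * (c\<^sup>2 + y\<^sup>2)" for c
      using \<delta> by (simp add: y_def power_mult_distrib power_divide distrib_left)
    from this[of "real k + 1"]
    have "2 * kern x (\<delta> * (real k + 1)) = 4 * x / ((2 * pi * \<delta>)\<^sup>2 * ((real k + 1)\<^sup>2 + y\<^sup>2))"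
      by (simp add: kern_def)
    also have "\<dots> = 1 / (pi * \<delta>) * (2 * y / ((real k + 1)\<^sup>2 + y\<^sup>2))"
      using \<delta> by (simp add: y_def power2_eq_square)
    finally show "1 / (pi * \<delta>) * (2 * y / ((real k + 1)\<^sup>2 + y\<^sup>2)) = 2 * kern x (\<delta> * (real k + 1))" ..
  qed
  finally show ?thesis .
qed

text \<open>The alternating series is the series of \<open>kern_sums_B\<close> minus twice its terms
  with odd \<open>k\<close>; those terms form the series for step \<open>2 \<delta>\<close>. The
  closed form then follows from \<open>coth_half\<close>.\<close>

lemma kern_sums_A:
  assumes \<delta>: "\<delta> > 0" and x: "x > 0"
  shows "(\<lambda>k. 2 * ((- 1) ^ k * kern x (\<delta> * (real k + 1)))) sums A_density \<delta> x"
proof -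
  define f where "f k = 2 * kern x (\<delta> * (real k + 1))" for k :: nat
  have f: "f sums B_density \<delta> x" unfolding f_def by (rule kern_sums_B[OF assms])
  define g where "g k = (if odd k then 2 * f k else 0)" for k
  have "(\<lambda>n. g (2 * n + 1)) sums (2 * B_density (2 * \<delta>) x)"
  proof -
    have "g (2 * n + 1) = 2 * (2 * kern x (2 * \<delta> * (real n + 1)))" for n
      by (simp add: g_def f_def algebra_simps)
    then show ?thesis using sums_mult[OF kern_sums_B[of "2 * \<delta>" x], of 2] assms by simp
  qed
  then have g: "g sums (2 * B_density (2 * \<delta>) x)"
    by (subst (asm) sums_mono_reindex)
      (auto simp: strict_mono_def g_def elim!: oddE)
  have "(\<lambda>k. f k - g k) sums (B_density \<delta> x - 2 * B_density (2 * \<delta>) x)"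
    by (intro sums_diff f g)
  also have "(\<lambda>k. f k - g k) = (\<lambda>k. 2 * ((- 1) ^ k * kern x (\<delta> * (real k + 1))))"
    by (auto simp: fun_eq_iff g_def f_def)
  also have "B_density \<delta> x - 2 * B_density (2 * \<delta>) x = A_density \<delta> x"
  proof -
    have "coth (x / (4 * \<delta>)) = coth (x / (2 * \<delta>)) + csch (x / (2 * \<delta>))"
      using coth_half[of "x / (2 * \<delta>)"] \<delta> x by simp
    then show ?thesis using \<delta> x by (simp add: A_density_def B_density_def field_simps)
  qed
  finally show ?thesis .
qed

text \<open>Leibniz estimate by induction: removing the first term leaves the negative of an
  alternating sum for the shifted sequence.\<close>

lemma alternating_sum_bounds:
  fixes f :: "nat \<Rightarrow> real"
  assumes "\<And>k. 0 \<le> f k" "\<And>k. f (Suc k) \<le> f k"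
  shows "0 \<le> (\<Sum>k<M. (- 1) ^ k * f k) \<and> (\<Sum>k<M. (- 1) ^ k * f k) \<le> f 0"
  using assms
proof (induction M arbitrary: f)
  case (Suc M)
  have "(\<Sum>k<Suc M. (- 1) ^ k * f k) = f 0 - (\<Sum>k<M. (- 1) ^ k * f (Suc k))"
    by (simp add: sum.lessThan_Suc_shift sum_negf del: sum.lessThan_Suc)
  moreover have "0 \<le> (\<Sum>k<M. (- 1) ^ k * f (Suc k)) \<and> (\<Sum>k<M. (- 1) ^ k * f (Suc k)) \<le> f (Suc 0)"
    using Suc.prems by (intro Suc.IH) auto
  ultimately show ?case using Suc.prems(2)[of 0] by linarith
qed simp

lemma kern_nonneg: "x \<ge> 0 \<Longrightarrow> 0 \<le> kern x t"
  by (simp add: kern_def)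

lemma kern_pos: "x > 0 \<Longrightarrow> 0 < kern x t"
  by (auto simp: kern_def intro!: divide_pos_pos add_pos_nonneg)

lemma kern_antimono:
  assumes "x > 0" "0 \<le> s" "s \<le> t"
  shows "kern x t \<le> kern x s"
  unfolding kern_def using assms
  by (intro divide_left_mono add_left_mono mult_left_mono power_mono mult_pos_pos add_pos_nonneg) auto

text \<open>Uniform in \<open>M\<close>, so that \<open>2 * kern x \<delta>\<close> can serve as
  dominating function when the series is integrated against the measure.\<close>

lemma kern_alternating_bounds:
  assumes "\<delta> > 0" "x > 0"
  shows "0 \<le> (\<Sum>k<M. 2 * ((- 1) ^ k * kern x (\<delta> * (real k + 1))))"
    and "(\<Sum>k<M. 2 * ((- 1) ^ k * kern x (\<delta> * (real k + 1)))) \<le> 2 * kern x \<delta>"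
proof -
  have "0 \<le> (\<Sum>k<M. (- 1) ^ k * kern x (\<delta> * (real k + 1))) \<and>
      (\<Sum>k<M. (- 1) ^ k * kern x (\<delta> * (real k + 1))) \<le> kern x (\<delta> * (real 0 + 1))"
    using assms by (intro alternating_sum_bounds kern_nonneg kern_antimono mult_left_mono) auto
  then show "0 \<le> (\<Sum>k<M. 2 * ((- 1) ^ k * kern x (\<delta> * (real k + 1))))"
    "(\<Sum>k<M. 2 * ((- 1) ^ k * kern x (\<delta> * (real k + 1)))) \<le> 2 * kern x \<delta>"
    by (simp_all flip: sum_distrib_left)
qed

text \<open>The upper bound passes from the alternating partial sums to their limit; positivity is
  \<open>sinh u > u\<close> at \<open>u = x / (2 \<delta>)\<close>.\<close>

lemma A_density_bounds:
  assumes \<delta>: "\<delta> > 0" and x: "x > 0"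
  shows "0 < A_density \<delta> x" "A_density \<delta> x \<le> 2 * kern x \<delta>"
proof -
  have lim: "(\<lambda>M. \<Sum>k<M. 2 * ((- 1) ^ k * kern x (\<delta> * (real k + 1)))) \<longlonglongrightarrow> A_density \<delta> x"
    using kern_sums_A[OF assms] by (simp add: sums_def)
  then show "A_density \<delta> x \<le> 2 * kern x \<delta>"
    by (rule LIMSEQ_le_const2) (use kern_alternating_bounds[OF assms] in auto)
  define u where "u = x / (2 * \<delta>)"
  have u: "u > 0" using \<delta> x by (simp add: u_def)
  have "sinh 0 - 0 < sinh u - u"
    using u
  proof (rule DERIV_pos_imp_increasing_open)
    fix z :: real assume "0 < z"
    then have "cosh z > 1" using cosh_real_nonneg_less_iff[of 0 z] by simp
    moreover have "((\<lambda>z. sinh z - z) has_real_derivative cosh z - 1) (at z)"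
      by (auto intro!: derivative_eq_intros)
    ultimately show "\<exists>d. ((\<lambda>z. sinh z - z) has_real_derivative d) (at z) \<and> 0 < d" by force
  qed (intro continuous_intros)
  then have "csch u < 1 / u" using u by (simp add: csch_def frac_less2)
  then have "1 / \<delta> * csch u < 1 / \<delta> * (1 / u)" using \<delta> by (intro mult_strict_left_mono) auto
  then show "0 < A_density \<delta> x" using \<delta> x by (simp add: A_density_def u_def)
qed

lemma B_density_partial_sums:
  assumes \<delta>: "\<delta> > 0" and x: "x > 0"
  shows "(\<Sum>k<M. 2 * kern x (\<delta> * (real k + 1))) \<le> B_density \<delta> x"
proof -
  note s = kern_sums_B[OF assms]
  have "(\<Sum>k<M. 2 * kern x (\<delta> * (real k + 1))) \<le> (\<Sum>k. 2 * kern x (\<delta> * (real k + 1)))"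
    by (rule sum_le_suminf[OF sums_summable[OF s]]) (use kern_nonneg[of x] x in auto)
  then show ?thesis using sums_unique[OF s] by simp
qed

text \<open>Positivity follows from the first term of the series. The upper bound, needed for
  integrability, rests on \<open>coth u - 1 / u\<close> being at most 1 and at most
  \<open>u\<close>, hence at most \<open>2 u / (1 + u)\<close>, where
  \<open>u = x / (2 \<delta>)\<close>.\<close>

lemma B_density_bounds:
  assumes \<delta>: "\<delta> > 0" and x: "x > 0"
  shows "0 < B_density \<delta> x" "B_density \<delta> x \<le> 2 / \<delta> * (1 + 1 / (2 * \<delta>)) * (x / (x + 1))"
proof -
  show "0 < B_density \<delta> x"
    using B_density_partial_sums[OF assms, of 1] kern_pos[OF x, of \<delta>] by simp
  define u where "u = x / (2 * \<delta>)"
  have u: "u > 0" using \<delta> x by (simp add: u_def)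
  then have sh: "sinh u > 0" by simp
  define c where "c = coth u - 1 / u"
  have "u * exp (- u) \<le> sinh u * 1"
    using le_sinh_real[of u] u by (intro mult_mono) auto
  then have "u * cosh u - sinh u \<le> u * sinh u"
    by (simp add: algebra_simps flip: cosh_minus_sinh)
  then have c1: "c \<le> 1" using u sh by (simp add: c_def coth_def field_simps)
  have "cosh 0 - 0 * sinh 0 \<ge> cosh u - u * sinh u"
    by (rule DERIV_nonpos_imp_nonincreasing[of 0 u "\<lambda>u. cosh u - u * sinh u"])
      (use u in \<open>auto intro!: exI derivative_eq_intros\<close>)
  then have "u * cosh u \<le> u * (1 + u * sinh u)" using u by (intro mult_left_mono) auto
  then have "u * cosh u - sinh u \<le> u * (u * sinh u)"
    using le_sinh_real[of u] u by (simp add: algebra_simps)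
  then have c2: "c \<le> u" using u sh by (simp add: c_def coth_def field_simps)
  have "c * (1 + u) \<le> 2 * u"
  proof -
    have "c * u \<le> 1 * u" using c1 u by (intro mult_right_mono) auto
    then show ?thesis using c2 unfolding distrib_left by linarith
  qed
  then have "c \<le> 2 * (u / (1 + u))" using u by (simp add: le_divide_eq)
  also have "u / (1 + u) \<le> (1 + 1 / (2 * \<delta>)) * (x / (x + 1))"
  proof -
    have "u / (1 + u) = x / (x + 2 * \<delta>)" using \<delta> x by (simp add: u_def field_simps)
    also have "\<dots> \<le> (1 + 1 / (2 * \<delta>)) * (x / (x + 1))"
    proof -
      have aux: "x / p \<le> K * (x / q)" if "p > 0" "q > 0" "q \<le> K * p" for p q K
        using mult_left_mono[OF that(3), of x] that(1,2) x by (simp add: field_simps)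
      \<comment> \<open>The factor is chosen so that the product contains both \<open>x\<close> and
        \<open>2 \<delta> / (2 \<delta>) = 1\<close>.\<close>
      have "x + 1 \<le> (1 + 1 / (2 * \<delta>)) * (x + 2 * \<delta>)" using \<delta> x by (simp add: field_simps)
      then show ?thesis using \<delta> x by (intro aux) auto
    qed
    finally show ?thesis .
  qed
  finally have "c \<le> 2 * ((1 + 1 / (2 * \<delta>)) * (x / (x + 1)))" by simp
  from mult_left_mono[OF this, of "1 / \<delta>"]
  have "1 / \<delta> * c \<le> 1 / \<delta> * (2 * ((1 + 1 / (2 * \<delta>)) * (x / (x + 1))))" using \<delta> by simp
  also have "1 / \<delta> * (2 * (K * r)) = 2 / \<delta> * K * r" for K r by simp
  finally have "1 / \<delta> * c \<le> 2 / \<delta> * (1 + 1 / (2 * \<delta>)) * (x / (x + 1))" .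
  moreover have "B_density \<delta> x = 1 / \<delta> * c" using \<delta> x by (simp add: B_density_def c_def u_def right_diff_distrib)
  ultimately show "B_density \<delta> x \<le> 2 / \<delta> * (1 + 1 / (2 * \<delta>)) * (x / (x + 1))" by simp
qed

section \<open>Integration over the measure\<close>

text \<open>Cesaro argument: if \<open>L > C\<close>, all terms from some index on exceed
  \<open>C\<close> by a fixed \<open>\<eta> > 0\<close>, and the accumulated excess
  \<open>T N\<close> grows linearly instead of staying nonpositive.\<close>

lemma LIMSEQ_le_if_sums_le:
  fixes S :: "nat \<Rightarrow> real"
  assumes lim: "S \<longlonglongrightarrow> L" and le: "\<And>N. (\<Sum>M\<le>N. S M) \<le> C * (real N + 1)"
  shows "L \<le> C"
proof (rule ccontr)
  assume "\<not> L \<le> C"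
  define \<eta> where "\<eta> = (L - C) / 2"
  have \<eta>: "\<eta> > 0" "C + \<eta> < L" using \<open>\<not> L \<le> C\<close> by (auto simp: \<eta>_def field_simps)
  obtain M0 where M0: "\<And>M. M \<ge> M0 \<Longrightarrow> C + \<eta> < S M"
    using order_tendstoD(1)[OF lim \<eta>(2)] by (auto simp: eventually_sequentially)
  define T where "T N = (\<Sum>M\<le>N. S M - C)" for N
  have T: "T N \<le> 0" for N using le[of N] by (simp add: T_def sum_subtractf algebra_simps)
  have step: "T M0 + real k * \<eta> \<le> T (M0 + k)" for k
  proof (induction k)
    case (Suc k)
    have "T (M0 + Suc k) = T (M0 + k) + (S (Suc (M0 + k)) - C)" by (simp add: T_def)
    then show ?case using Suc M0[of "Suc (M0 + k)"] by (simp add: algebra_simps)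
  qed simp
  obtain k where "- T M0 < real k * \<eta>"
    using reals_Archimedean3[OF \<eta>(1)] by blast
  then show False using step[of k] T[of "M0 + k"] by linarith
qed

section \<open>The form on arithmetic progressions\<close>

lemma offdiag_form_Suc:
  assumes "\<And>t. c (- t) = c t"
  shows "offdiag_form (Suc N) \<xi> u c = offdiag_form N \<xi> u c + 2 * (\<Sum>n=0..N. u (Suc N) * u n * c (\<xi> (Suc N) - \<xi> n))"
proof -
  have c: "c (\<xi> m - \<xi> n) = c (\<xi> n - \<xi> m)" for m n using assms[of "\<xi> n - \<xi> m"] by simp
  have "(\<Sum>n\<in>{0..Suc N} - {m}. u m * u n * c (\<xi> m - \<xi> n)) =
      u (Suc N) * u m * c (\<xi> (Suc N) - \<xi> m) + (\<Sum>n\<in>{0..N} - {m}. u m * u n * c (\<xi> m - \<xi> n))"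
    if "m \<in> {0..N}" for m
  proof -
    have "{0..Suc N} - {m} = insert (Suc N) ({0..N} - {m})" using that by auto
    then show ?thesis using c[of m "Suc N"] by simp
  qed
  moreover have "{0..Suc N} - {Suc N} = {0..N}" by auto
  ultimately show ?thesis
    by (simp add: offdiag_form_def sum.distrib)
qed

text \<open>The point of index \<open>M\<close> contributes twice the sum over its differences
  \<open>\<delta> (k + 1)\<close> to the earlier points, and \<open>\<sigma>^M * \<sigma>^n\<close>
  depends only on \<open>M - n\<close> because \<open>\<sigma>^2 = 1\<close>. The form thus becomes
  a sum of partial sums, as required by \<open>LIMSEQ_le_if_sums_le\<close>.\<close>

lemma offdiag_form_arithmetic:
  fixes \<sigma> \<delta> :: real
  assumes even: "\<And>t. c (- t) = c t" and \<sigma>: "\<sigma>\<^sup>2 = 1"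
  shows "offdiag_form N (\<lambda>n. \<delta> * real n) (\<lambda>n. \<sigma> ^ n) c =
    (\<Sum>M\<le>N. \<Sum>k<M. 2 * (\<sigma> ^ Suc k * c (\<delta> * (real k + 1))))"
proof (induction N)
  case 0
  then show ?case by (simp add: offdiag_form_def)
next
  case (Suc N)
  define g where "g n = \<sigma> ^ Suc N * \<sigma> ^ n * c (\<delta> * real (Suc N) - \<delta> * real n)" for n
  have "(\<Sum>n=0..N. g n) = (\<Sum>n<Suc N. g n)"
    by (simp only: atLeast0AtMost lessThan_Suc_atMost)
  also have "\<dots> = (\<Sum>k<Suc N. g (Suc N - Suc k))"
    by (rule sum.nat_diff_reindex[symmetric])
  also have "\<dots> = (\<Sum>k<Suc N. \<sigma> ^ Suc k * c (\<delta> * (real k + 1)))"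
  proof (rule sum.cong[OF refl])
    fix k assume "k \<in> {..<Suc N}"
    then have k: "k \<le> N" by simp
    have "\<sigma> ^ Suc N * \<sigma> ^ (N - k) = \<sigma> ^ (Suc k + 2 * (N - k))"
    proof -
      have "Suc N + (N - k) = Suc k + 2 * (N - k)" using k by simp
      then show ?thesis by (simp only: flip: power_add)
    qed
    also have "\<dots> = \<sigma> ^ Suc k" by (simp only: power_add power_mult \<sigma>) simp
    finally have "\<sigma> ^ Suc N * \<sigma> ^ (N - k) = \<sigma> ^ Suc k" .
    moreover have "\<delta> * real (Suc N) - \<delta> * real (N - k) = \<delta> * (real k + 1)"
      using k by (simp add: of_nat_diff algebra_simps)
    ultimately show "g (Suc N - Suc k) = \<sigma> ^ Suc k * c (\<delta> * (real k + 1))"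
      by (simp add: g_def)
  qed
  finally show ?case
    using Suc by (simp only: offdiag_form_Suc[of c, OF even] sum.atMost_Suc g_def sum_distrib_left)
qed

lemma separated_arithmetic:
  assumes "\<delta> > 0"
  shows "separated \<delta> N (\<lambda>n. \<delta> * real n)"
  unfolding separated_def
proof (intro allI impI)
  fix m n :: nat assume "m \<noteq> n"
  then have "1 \<le> \<bar>real m - real n\<bar>" by linarith
  then have "\<delta> * 1 \<le> \<delta> * \<bar>real m - real n\<bar>" using assms by (intro mult_left_mono) auto
  then show "\<delta> \<le> \<bar>\<delta> * real m - \<delta> * real n\<bar>" using assms by (simp add: abs_mult flip: right_diff_distrib)
qed

section \<open>Reduction to real coefficients\<close>

lemma r_kernel_minus: "r_kernel \<mu> (- t) = r_kernel \<mu> t"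
  by (simp add: r_kernel_def)

lemma r_kernel_eq: "r_kernel \<mu> t = (LINT x|\<mu>. kern x t)"
  by (simp add: r_kernel_def kern_def)

lemma A_const_eq: "A_const \<delta> \<mu> = integral\<^sup>L \<mu> (A_density \<delta>)"
  unfolding A_const_def A_density_def ..

lemma B_const_eq: "B_const \<delta> \<mu> = integral\<^sup>L \<mu> (B_density \<delta>)"
  unfolding B_const_def B_density_def ..

text \<open>The kernel is even, so the mixed products of real and imaginary parts cancel under
  exchange of \<open>m\<close> and \<open>n\<close>.\<close>

lemma hermitian_form_eq:
  "hermitian_form \<mu> N \<xi> a = complex_of_real
     (offdiag_form N \<xi> (\<lambda>n. Re (a n)) (r_kernel \<mu>) + offdiag_form N \<xi> (\<lambda>n. Im (a n)) (r_kernel \<mu>))"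
proof -
  \<comment> \<open>Setting the diagonal to 0 lets both indices range over the full interval, so
    that the summations can be swapped.\<close>
  define d where "d m n = (if n = m then 0 else r_kernel \<mu> (\<xi> m - \<xi> n))" for m n
  have full: "(\<Sum>n\<in>{0..N} - {m}. f n * r_kernel \<mu> (\<xi> m - \<xi> n)) = (\<Sum>n=0..N. f n * d m n)"
    for m and f :: "nat \<Rightarrow> real"
    by (rule sum.mono_neutral_cong_left) (auto simp: d_def)
  have d: "d m n = d n m" for m n
    using r_kernel_minus[of \<mu> "\<xi> n - \<xi> m"] by (simp add: d_def)
  have "(\<Sum>m=0..N. \<Sum>n=0..N. Im (a m) * Re (a n) * d m n) = (\<Sum>m=0..N. \<Sum>n=0..N. Re (a m) * Im (a n) * d m n)"
    by (subst sum.swap) (simp add: d mult_ac)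
  then have "Im (hermitian_form \<mu> N \<xi> a) = 0"
    by (simp add: hermitian_form_def full left_diff_distrib sum_subtractf flip: minus_mult_left)
  moreover have "Re (hermitian_form \<mu> N \<xi> a) =
      offdiag_form N \<xi> (\<lambda>n. Re (a n)) (r_kernel \<mu>) + offdiag_form N \<xi> (\<lambda>n. Im (a n)) (r_kernel \<mu>)"
    by (simp add: hermitian_form_def offdiag_form_def distrib_right sum.distrib)
  ultimately show ?thesis by (simp add: complex_eq_iff)
qed

lemma lower_inequality_iff:
  "lower_inequality \<delta> \<mu> C \<longleftrightarrow> (\<forall>N \<xi> u. separated \<delta> N \<xi> \<longrightarrow>
     - C * (\<Sum>n=0..N. (u n)\<^sup>2) \<le> offdiag_form N \<xi> u (r_kernel \<mu>))"
proof (intro iffI allI impI)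
  fix N \<xi> u assume L: "lower_inequality \<delta> \<mu> C" and sep: "separated \<delta> N \<xi>"
  have "complex_of_real (- C * (\<Sum>n=0..N. (cmod (complex_of_real (u n)))\<^sup>2)) \<le> hermitian_form \<mu> N \<xi> (\<lambda>n. complex_of_real (u n))"
    using L[unfolded lower_inequality_def, rule_format, OF sep] .
  then show "- C * (\<Sum>n=0..N. (u n)\<^sup>2) \<le> offdiag_form N \<xi> u (r_kernel \<mu>)"
    unfolding hermitian_form_eq by (simp add: offdiag_form_def less_eq_complex_def)
next
  assume R: "\<forall>N \<xi> u. separated \<delta> N \<xi> \<longrightarrow> - C * (\<Sum>n=0..N. (u n)\<^sup>2) \<le> offdiag_form N \<xi> u (r_kernel \<mu>)"
  show "lower_inequality \<delta> \<mu> C"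
    unfolding lower_inequality_def
  proof (intro allI impI)
    fix N \<xi> a assume sep: "separated \<delta> N \<xi>"
    have "- C * (\<Sum>n=0..N. (Re (a n))\<^sup>2) \<le> offdiag_form N \<xi> (\<lambda>n. Re (a n)) (r_kernel \<mu>)"
      "- C * (\<Sum>n=0..N. (Im (a n))\<^sup>2) \<le> offdiag_form N \<xi> (\<lambda>n. Im (a n)) (r_kernel \<mu>)"
      by (rule R[rule_format, OF sep])+
    then show "complex_of_real (- C * (\<Sum>n=0..N. (cmod (a n))\<^sup>2)) \<le> hermitian_form \<mu> N \<xi> a"
      unfolding hermitian_form_eq by (simp add: less_eq_complex_def cmod_power2 sum.distrib distrib_left)
  qed
qed

lemma upper_inequality_iff:
  "upper_inequality \<delta> \<mu> C \<longleftrightarrow> (\<forall>N \<xi> u. separated \<delta> N \<xi> \<longrightarrow>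
     offdiag_form N \<xi> u (r_kernel \<mu>) \<le> C * (\<Sum>n=0..N. (u n)\<^sup>2))"
proof (intro iffI allI impI)
  fix N \<xi> u assume L: "upper_inequality \<delta> \<mu> C" and sep: "separated \<delta> N \<xi>"
  have "hermitian_form \<mu> N \<xi> (\<lambda>n. complex_of_real (u n)) \<le> complex_of_real (C * (\<Sum>n=0..N. (cmod (complex_of_real (u n)))\<^sup>2))"
    using L[unfolded upper_inequality_def, rule_format, OF sep] .
  then show "offdiag_form N \<xi> u (r_kernel \<mu>) \<le> C * (\<Sum>n=0..N. (u n)\<^sup>2)"
    unfolding hermitian_form_eq by (simp add: offdiag_form_def less_eq_complex_def)
next
  assume R: "\<forall>N \<xi> u. separated \<delta> N \<xi> \<longrightarrow> offdiag_form N \<xi> u (r_kernel \<mu>) \<le> C * (\<Sum>n=0..N. (u n)\<^sup>2)"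
  show "upper_inequality \<delta> \<mu> C"
    unfolding upper_inequality_def
  proof (intro allI impI)
    fix N \<xi> a assume sep: "separated \<delta> N \<xi>"
    have "offdiag_form N \<xi> (\<lambda>n. Re (a n)) (r_kernel \<mu>) \<le> C * (\<Sum>n=0..N. (Re (a n))\<^sup>2)"
      "offdiag_form N \<xi> (\<lambda>n. Im (a n)) (r_kernel \<mu>) \<le> C * (\<Sum>n=0..N. (Im (a n))\<^sup>2)"
      by (rule R[rule_format, OF sep])+
    then show "hermitian_form \<mu> N \<xi> a \<le> complex_of_real (C * (\<Sum>n=0..N. (cmod (a n))\<^sup>2))"
      unfolding hermitian_form_eq by (simp add: less_eq_complex_def cmod_power2 sum.distrib distrib_left)
  qed
qed

section \<open>Integration of the point-mass bounds, and sharpness\<close>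

locale halfline_measure =
  fixes \<mu> :: "real measure"
  assumes sets_\<mu>: "sets \<mu> = sets (restrict_space borel {0<..})"
begin

lemma space_\<mu>: "space \<mu> = {0<..}"
  using sets_eq_imp_space_eq[OF sets_\<mu>] by (simp add: space_restrict_space)

lemma borel_measurable_\<mu>: "f \<in> borel_measurable borel \<Longrightarrow> f \<in> borel_measurable \<mu>"
  unfolding measurable_cong_sets[OF sets_\<mu> refl] by (rule measurable_restrict_space1)

lemma integrable_if_nn_integral:
  assumes "(\<integral>\<^sup>+x. ennreal (f x) \<partial>\<mu>) < \<infinity>" "f \<in> borel_measurable borel" "\<And>x. x > 0 \<Longrightarrow> 0 \<le> f x"
  shows "integrable \<mu> f"
  using assms by (intro integrableI_nonneg borel_measurable_\<mu>) (auto simp: space_\<mu>)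

text \<open>The condition on \<open>g\<close> guarantees that \<open>\<mu>\<close> is not the null
  measure; a vanishing integral of the everywhere positive \<open>f\<close> would contradict
  this.\<close>

lemma integral_pos:
  fixes f :: "real \<Rightarrow> real"
  assumes "integrable \<mu> f" "\<And>x. x > 0 \<Longrightarrow> 0 < f x" "0 < (\<integral>\<^sup>+x. g x \<partial>\<mu>)"
  shows "0 < integral\<^sup>L \<mu> f"
proof -
  have "0 \<le> integral\<^sup>L \<mu> f"
    by (rule Bochner_Integration.integral_nonneg_AE, rule AE_I2) (use assms(2) in \<open>auto simp: space_\<mu> less_imp_le\<close>)
  moreover have "integral\<^sup>L \<mu> f \<noteq> 0"
  proof
    assume "integral\<^sup>L \<mu> f = 0"
    then have "AE x in \<mu>. f x = 0"
      using assms(1,2) by (subst (asm) integral_nonneg_eq_0_iff_AE) (auto simp: space_\<mu> less_imp_le intro!: AE_I2)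
    moreover have "AE x in \<mu>. f x \<noteq> 0"
      by (intro AE_I2) (metis assms(2) greaterThan_iff less_irrefl space_\<mu>)
    ultimately have "AE x in \<mu>. False" by eventually_elim simp
    then have "(\<integral>\<^sup>+x. g x \<partial>\<mu>) = (\<integral>\<^sup>+x. 0 \<partial>\<mu>)" by (intro nn_integral_cong_AE) (auto elim: eventually_mono)
    then show False using assms(3) by simp
  qed
  ultimately show ?thesis by simp
qed

lemma integrable_kern:
  assumes I: "integrable \<mu> (\<lambda>x. x / (x\<^sup>2 + 1))" and t: "t \<noteq> 0"
  shows "integrable \<mu> (\<lambda>x. kern x t)"
proof -
  \<comment> \<open>Chosen so that \<open>m (x^2 + 1) \<le> x^2 + 4 pi^2 t^2\<close>.\<close>
  define m where "m = min 1 (4 * pi\<^sup>2 * t\<^sup>2)"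
  have m: "m > 0" "m \<le> 1" "m \<le> 4 * pi\<^sup>2 * t\<^sup>2" using t by (auto simp: m_def)
  show ?thesis
  proof (rule Bochner_Integration.integrable_bound)
    show "integrable \<mu> (\<lambda>x. 2 / m * (x / (x\<^sup>2 + 1)))"
      using I by (rule integrable_mult_right)
    show "AE x in \<mu>. norm (kern x t) \<le> norm (2 / m * (x / (x\<^sup>2 + 1)))"
    proof (rule AE_I2)
      fix x assume "x \<in> space \<mu>"
      then have x: "x > 0" by (simp add: space_\<mu>)
      have "m * x\<^sup>2 \<le> 1 * x\<^sup>2" using m by (intro mult_right_mono) auto
      then have "m * (x\<^sup>2 + 1) \<le> x\<^sup>2 + 4 * pi\<^sup>2 * t\<^sup>2" using m by (simp add: distrib_left)
      then have "2 * x / (x\<^sup>2 + 4 * pi\<^sup>2 * t\<^sup>2) \<le> 2 * x / (m * (x\<^sup>2 + 1))"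
        using x m by (intro divide_left_mono mult_pos_pos add_pos_nonneg) auto
      also have "\<dots> = 2 / m * (x / (x\<^sup>2 + 1))" by simp
      finally have "kern x t \<le> 2 / m * (x / (x\<^sup>2 + 1))" by (simp add: kern_def)
      then show "norm (kern x t) \<le> norm (2 / m * (x / (x\<^sup>2 + 1)))"
        using kern_nonneg[of x t] x unfolding real_norm_def by linarith
    qed
    show "(\<lambda>x. kern x t) \<in> borel_measurable \<mu>"
      unfolding kern_def by (intro borel_measurable_\<mu>) measurable
  qed
qed

text \<open>Separation keeps all differences away from 0, where the kernel may fail to be
  integrable.\<close>

lemma offdiag_form_integral:
  assumes I: "integrable \<mu> (\<lambda>x. x / (x\<^sup>2 + 1))" and \<delta>: "\<delta> > 0" and sep: "separated \<delta> N \<xi>"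
  shows "has_bochner_integral \<mu> (\<lambda>x. offdiag_form N \<xi> u (kern x)) (offdiag_form N \<xi> u (r_kernel \<mu>))"
  unfolding offdiag_form_def
proof (intro has_bochner_integral_sum has_bochner_integral_mult_right)
  fix m n assume "m \<in> {0..N}" "n \<in> {0..N} - {m}"
  then have "\<delta> \<le> \<bar>\<xi> m - \<xi> n\<bar>" using sep by (auto simp: separated_def)
  then have "\<xi> m - \<xi> n \<noteq> 0" using \<delta> by auto
  then show "has_bochner_integral \<mu> (\<lambda>x. kern x (\<xi> m - \<xi> n)) (r_kernel \<mu> (\<xi> m - \<xi> n))"
    using integrable_kern[OF I] by (simp add: has_bochner_integral_iff r_kernel_eq)
qed

lemma partial_sum_integral:
  assumes I: "integrable \<mu> (\<lambda>x. x / (x\<^sup>2 + 1))" and \<delta>: "\<delta> > 0"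
  shows "has_bochner_integral \<mu> (\<lambda>x. \<Sum>k<M. 2 * (s k * kern x (\<delta> * (real k + 1))))
    (\<Sum>k<M. 2 * (s k * r_kernel \<mu> (\<delta> * (real k + 1))))"
proof (intro has_bochner_integral_sum has_bochner_integral_mult_right)
  fix k
  have "\<delta> * (real k + 1) \<noteq> 0" using \<delta> by simp
  then show "has_bochner_integral \<mu> (\<lambda>x. kern x (\<delta> * (real k + 1))) (r_kernel \<mu> (\<delta> * (real k + 1)))"
    using integrable_kern[OF I] by (simp add: has_bochner_integral_iff r_kernel_eq)
qed

lemma borel_measurable_A_density: "A_density \<delta> \<in> borel_measurable \<mu>"
proof -
  have [measurable]: "sinh \<in> borel_measurable (borel :: real measure)"
    by (intro borel_measurable_continuous_onI continuous_intros)
  show ?thesis unfolding A_density_def csch_def by (intro borel_measurable_\<mu>) measurable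
qed

lemma borel_measurable_B_density: "B_density \<delta> \<in> borel_measurable \<mu>"
proof -
  have [measurable]: "sinh \<in> borel_measurable (borel :: real measure)" "cosh \<in> borel_measurable (borel :: real measure)"
    by (intro borel_measurable_continuous_onI continuous_intros)+
  show ?thesis unfolding B_density_def coth_def by (intro borel_measurable_\<mu>) measurable
qed

text \<open>The inequality is the integral of the point-mass bound. Sharpness is tested on
  \<open>\<xi> n = \<delta> n\<close> with \<open>u n = (- 1)^n\<close>: the form is minus the sum
  of the \<open>S M\<close>, the squares add up to \<open>N + 1\<close>, and \<open>S\<close>
  converges to the constant by dominated convergence.\<close>

lemma
  assumes I: "integrable \<mu> (\<lambda>x. x / (x\<^sup>2 + 1))" and \<delta>: "\<delta> > 0"
  shows integrable_A_density: "integrable \<mu> (A_density \<delta>)"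
    and lower_inequality_A_const: "lower_inequality \<delta> \<mu> (A_const \<delta> \<mu>)"
    and A_const_le: "lower_inequality \<delta> \<mu> C \<Longrightarrow> A_const \<delta> \<mu> \<le> C"
proof -
  have I2: "integrable \<mu> (\<lambda>x. 2 * kern x \<delta>)" using integrable_kern[OF I, of \<delta>] \<delta> by simp
  show int: "integrable \<mu> (A_density \<delta>)"
  proof (rule Bochner_Integration.integrable_bound[OF I2 borel_measurable_A_density])
    show "AE x in \<mu>. norm (A_density \<delta> x) \<le> norm (2 * kern x \<delta>)"
      using A_density_bounds[OF \<delta>] by (intro AE_I2) (fastforce simp: space_\<mu>)
  qed
  show "lower_inequality \<delta> \<mu> (A_const \<delta> \<mu>)"
    unfolding lower_inequality_iff
  proof (intro allI impI)
    fix N \<xi> u assume sep: "separated \<delta> N \<xi>"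
    note F = offdiag_form_integral[OF I \<delta> sep, of u]
    have "(LINT x|\<mu>. - A_density \<delta> x * (\<Sum>n=0..N. (u n)\<^sup>2)) \<le> (LINT x|\<mu>. offdiag_form N \<xi> u (kern x))"
      using F offdiag_form_kern_bounds(1)[OF \<delta> _ sep] int
      by (intro integral_mono) (auto simp: has_bochner_integral_iff space_\<mu>)
    then show "- A_const \<delta> \<mu> * (\<Sum>n=0..N. (u n)\<^sup>2) \<le> offdiag_form N \<xi> u (r_kernel \<mu>)"
      using F int by (simp add: has_bochner_integral_iff A_const_eq)
  qed
  assume C: "lower_inequality \<delta> \<mu> C"
  define S where "S M = (\<Sum>k<M. 2 * ((- 1) ^ k * r_kernel \<mu> (\<delta> * (real k + 1))))" for M
  have S: "has_bochner_integral \<mu> (\<lambda>x. \<Sum>k<M. 2 * ((- 1) ^ k * kern x (\<delta> * (real k + 1)))) (S M)" for M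
    unfolding S_def by (rule partial_sum_integral[OF I \<delta>])
  have "S \<longlonglongrightarrow> A_const \<delta> \<mu>"
  proof -
    have "(\<lambda>M. LINT x|\<mu>. (\<Sum>k<M. 2 * ((- 1) ^ k * kern x (\<delta> * (real k + 1))))) \<longlonglongrightarrow> A_const \<delta> \<mu>"
      unfolding A_const_eq
    proof (rule integral_dominated_convergence[OF borel_measurable_A_density _ I2])
      show "AE x in \<mu>. (\<lambda>M. \<Sum>k<M. 2 * ((- 1) ^ k * kern x (\<delta> * (real k + 1)))) \<longlonglongrightarrow> A_density \<delta> x"
        using kern_sums_A[OF \<delta>] by (intro AE_I2) (simp add: space_\<mu> sums_def)
      show "AE x in \<mu>. norm (\<Sum>k<M. 2 * ((- 1) ^ k * kern x (\<delta> * (real k + 1)))) \<le> 2 * kern x \<delta>" for M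
        using kern_alternating_bounds[OF \<delta>] by (intro AE_I2) (simp add: space_\<mu>)
    qed (use S in \<open>auto simp: has_bochner_integral_iff\<close>)
    then show ?thesis using S by (simp add: has_bochner_integral_iff)
  qed
  then show "A_const \<delta> \<mu> \<le> C"
  proof (rule LIMSEQ_le_if_sums_le)
    fix N
    have "- C * (\<Sum>n=0..N. ((- 1) ^ n)\<^sup>2) \<le> offdiag_form N (\<lambda>n. \<delta> * real n) (\<lambda>n. (- 1) ^ n) (r_kernel \<mu>)"
      using C separated_arithmetic[OF \<delta>] unfolding lower_inequality_iff by blast
    also have "\<dots> = - (\<Sum>M\<le>N. S M)"
      by (simp add: offdiag_form_arithmetic[where c = "r_kernel \<mu>", OF r_kernel_minus] S_def sum_negf)
    finally show "(\<Sum>M\<le>N. S M) \<le> C * (real N + 1)" by (simp add: add.commute flip: power_mult)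
  qed
qed

lemma
  assumes J: "integrable \<mu> (\<lambda>x. x / (x + 1))" and \<delta>: "\<delta> > 0"
  shows integrable_B_density: "integrable \<mu> (B_density \<delta>)"
    and upper_inequality_B_const: "upper_inequality \<delta> \<mu> (B_const \<delta> \<mu>)"
    and B_const_le: "upper_inequality \<delta> \<mu> C \<Longrightarrow> B_const \<delta> \<mu> \<le> C"
proof -
  \<comment> \<open>The second hypothesis implies integrability of all needed kernel values:
    \<open>x + 1 \<le> 2 (x^2 + 1)\<close> because the difference is
    \<open>(x - 1)^2 + x^2 + x\<close>.\<close>
  have I: "integrable \<mu> (\<lambda>x. x / (x\<^sup>2 + 1))"
  proof (rule Bochner_Integration.integrable_bound)
    show "integrable \<mu> (\<lambda>x. 2 * (x / (x + 1)))" using J by (rule integrable_mult_right)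
    show "AE x in \<mu>. norm (x / (x\<^sup>2 + 1)) \<le> norm (2 * (x / (x + 1)))"
    proof (rule AE_I2)
      fix x assume "x \<in> space \<mu>"
      then have x: "x > 0" by (simp add: space_\<mu>)
      have "0 \<le> (x - 1)\<^sup>2 + x\<^sup>2 + x" using x by simp
      then have "x + 1 \<le> 2 * (x\<^sup>2 + 1)" by (simp add: power2_eq_square algebra_simps)
      then have "2 * x / (2 * (x\<^sup>2 + 1)) \<le> 2 * x / (x + 1)"
        using x by (intro divide_left_mono mult_pos_pos add_nonneg_pos) auto
      also have "2 * x / (2 * (x\<^sup>2 + 1)) = x / (x\<^sup>2 + 1)"
        by (rule mult_divide_mult_cancel_left) simp
      finally show "norm (x / (x\<^sup>2 + 1)) \<le> norm (2 * (x / (x + 1)))" using x by simp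
    qed
  qed (intro borel_measurable_\<mu>, measurable)
  show int: "integrable \<mu> (B_density \<delta>)"
  proof (rule Bochner_Integration.integrable_bound[OF _ borel_measurable_B_density])
    show "integrable \<mu> (\<lambda>x. 2 / \<delta> * (1 + 1 / (2 * \<delta>)) * (x / (x + 1)))"
      using J by (rule integrable_mult_right)
    show "AE x in \<mu>. norm (B_density \<delta> x) \<le> norm (2 / \<delta> * (1 + 1 / (2 * \<delta>)) * (x / (x + 1)))"
    proof (rule AE_I2)
      fix x assume "x \<in> space \<mu>"
      then have "0 < B_density \<delta> x" "B_density \<delta> x \<le> 2 / \<delta> * (1 + 1 / (2 * \<delta>)) * (x / (x + 1))"
        using B_density_bounds[OF \<delta>] by (auto simp: space_\<mu>)
      then show "norm (B_density \<delta> x) \<le> norm (2 / \<delta> * (1 + 1 / (2 * \<delta>)) * (x / (x + 1)))"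
        unfolding real_norm_def by linarith
    qed
  qed
  show "upper_inequality \<delta> \<mu> (B_const \<delta> \<mu>)"
    unfolding upper_inequality_iff
  proof (intro allI impI)
    fix N \<xi> u assume sep: "separated \<delta> N \<xi>"
    note F = offdiag_form_integral[OF I \<delta> sep, of u]
    have "(LINT x|\<mu>. offdiag_form N \<xi> u (kern x)) \<le> (LINT x|\<mu>. B_density \<delta> x * (\<Sum>n=0..N. (u n)\<^sup>2))"
      using F offdiag_form_kern_bounds(2)[OF \<delta> _ sep] int
      by (intro integral_mono) (auto simp: has_bochner_integral_iff space_\<mu>)
    then show "offdiag_form N \<xi> u (r_kernel \<mu>) \<le> B_const \<delta> \<mu> * (\<Sum>n=0..N. (u n)\<^sup>2)"
      using F int by (simp add: has_bochner_integral_iff B_const_eq)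
  qed
  assume C: "upper_inequality \<delta> \<mu> C"
  define S where "S M = (\<Sum>k<M. 2 * (1 * r_kernel \<mu> (\<delta> * (real k + 1))))" for M
  have S: "has_bochner_integral \<mu> (\<lambda>x. \<Sum>k<M. 2 * (1 * kern x (\<delta> * (real k + 1)))) (S M)" for M
    unfolding S_def by (rule partial_sum_integral[OF I \<delta>])
  have "S \<longlonglongrightarrow> B_const \<delta> \<mu>"
  proof -
    have "(\<lambda>M. LINT x|\<mu>. (\<Sum>k<M. 2 * (1 * kern x (\<delta> * (real k + 1))))) \<longlonglongrightarrow> B_const \<delta> \<mu>"
      unfolding B_const_eq
    \<comment> \<open>All terms are nonnegative, so the integrable limit itself dominates the
      partial sums.\<close>
    proof (rule integral_dominated_convergence[OF borel_measurable_B_density _ int])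
      show "AE x in \<mu>. (\<lambda>M. \<Sum>k<M. 2 * (1 * kern x (\<delta> * (real k + 1)))) \<longlonglongrightarrow> B_density \<delta> x"
        using kern_sums_B[OF \<delta>] by (intro AE_I2) (simp add: space_\<mu> sums_def)
      show "AE x in \<mu>. norm (\<Sum>k<M. 2 * (1 * kern x (\<delta> * (real k + 1)))) \<le> B_density \<delta> x" for M
        using B_density_partial_sums[OF \<delta>] kern_nonneg
        by (intro AE_I2) (simp add: space_\<mu> abs_of_nonneg sum_nonneg)
    qed (use S in \<open>auto simp: has_bochner_integral_iff\<close>)
    then show ?thesis using S by (simp add: has_bochner_integral_iff)
  qed
  then show "B_const \<delta> \<mu> \<le> C"
  proof (rule LIMSEQ_le_if_sums_le)
    fix N
    have "offdiag_form N (\<lambda>n. \<delta> * real n) (\<lambda>n. 1 ^ n) (r_kernel \<mu>) \<le> C * (\<Sum>n=0..N. (1 ^ n)\<^sup>2)"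
      using C separated_arithmetic[OF \<delta>] unfolding upper_inequality_iff by blast
    moreover have "offdiag_form N (\<lambda>n. \<delta> * real n) (\<lambda>n. 1 ^ n) (r_kernel \<mu>) = (\<Sum>M\<le>N. S M)"
      by (subst offdiag_form_arithmetic[where c = "r_kernel \<mu>", OF r_kernel_minus]) (simp_all add: S_def)
    ultimately show "(\<Sum>M\<le>N. S M) \<le> C * (real N + 1)" by (simp add: add.commute)
  qed
qed

end

theorem theorem7p1:
  fixes \<mu> :: "real measure" and \<delta> :: real
  assumes "sets \<mu> = sets (restrict_space borel {0<..})"
    and "\<delta> > 0"
  shows
    "(0 < (\<integral>\<^sup>+x. ennreal (x / (x\<^sup>2 + 1)) \<partial>\<mu>) \<and> (\<integral>\<^sup>+x. ennreal (x / (x\<^sup>2 + 1)) \<partial>\<mu>) < \<infinity> \<longrightarrow>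
        lower_inequality \<delta> \<mu> (A_const \<delta> \<mu>) \<and> 0 < A_const \<delta> \<mu> \<and>
        (\<forall>C. C < A_const \<delta> \<mu> \<longrightarrow> \<not> lower_inequality \<delta> \<mu> C)) \<and>
     (0 < (\<integral>\<^sup>+x. ennreal (x / (x + 1)) \<partial>\<mu>) \<and> (\<integral>\<^sup>+x. ennreal (x / (x + 1)) \<partial>\<mu>) < \<infinity> \<longrightarrow>
        upper_inequality \<delta> \<mu> (B_const \<delta> \<mu>) \<and> 0 < B_const \<delta> \<mu> \<and>
        (\<forall>C. C < B_const \<delta> \<mu> \<longrightarrow> \<not> upper_inequality \<delta> \<mu> C))"
proof (intro conjI impI)
  interpret halfline_measure \<mu> by standard (fact assms(1))
  {
    assume h: "0 < (\<integral>\<^sup>+x. ennreal (x / (x\<^sup>2 + 1)) \<partial>\<mu>) \<and> (\<integral>\<^sup>+x. ennreal (x / (x\<^sup>2 + 1)) \<partial>\<mu>) < \<infinity>"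
    \<comment> \<open>Finiteness gives Bochner integrability, so that \<open>A_const\<close> and the
      kernel values at nonzero arguments are genuine integrals rather than the default 0.\<close>
    then have I: "integrable \<mu> (\<lambda>x. x / (x\<^sup>2 + 1))" by (intro integrable_if_nn_integral) auto
    show "lower_inequality \<delta> \<mu> (A_const \<delta> \<mu>)" by (rule lower_inequality_A_const[OF I assms(2)])
    have "0 < integral\<^sup>L \<mu> (A_density \<delta>)"
      using integral_pos[OF integrable_A_density[OF I assms(2)] A_density_bounds(1)[OF assms(2)]] h by blast
    then show "0 < A_const \<delta> \<mu>" by (simp add: A_const_eq)
    show "\<forall>C. C < A_const \<delta> \<mu> \<longrightarrow> \<not> lower_inequality \<delta> \<mu> C"
      using A_const_le[OF I assms(2)] by force
  }
  {
    assume h: "0 < (\<integral>\<^sup>+x. ennreal (x / (x + 1)) \<partial>\<mu>) \<and> (\<integral>\<^sup>+x. ennreal (x / (x + 1)) \<partial>\<mu>) < \<infinity>"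
    then have J: "integrable \<mu> (\<lambda>x. x / (x + 1))" by (intro integrable_if_nn_integral) auto
    show "upper_inequality \<delta> \<mu> (B_const \<delta> \<mu>)" by (rule upper_inequality_B_const[OF J assms(2)])
    have "0 < integral\<^sup>L \<mu> (B_density \<delta>)"
      using integral_pos[OF integrable_B_density[OF J assms(2)] B_density_bounds(1)[OF assms(2)]] h by blast
    then show "0 < B_const \<delta> \<mu>" by (simp add: B_const_eq)
    show "\<forall>C. C < B_const \<delta> \<mu> \<longrightarrow> \<not> upper_inequality \<delta> \<mu> C"
      using B_const_le[OF J assms(2)] by force
  }
qed

end
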